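(* Consider the Bernoulli group testing model described in the context, with fixed rate $R$ satisfying $\frac12<R<1$ and with $k=\Theta(p^{\alpha})$ for some constant $\alpha\in(0,1)$. For every $\epsilon>0$ there exists a constant $C=C(\epsilon)$ such that, asymptotically almost surely as $p\to+\infty$, for every integer $\ell\in\{0,1,\ldots,\lfloor(1-\epsilon)k\rfloor\}$, $$\phi(\ell)\ \ge\ n_{\mathrm{pos}}\,F_{p'}\!\left(\frac{\ell}{k}\right)-C\ln k .$$
   Context: Model. There are $p$ items, $k$ of which are defective; the defective set is uniformly random among $k$-subsets. One performs $n$ tests; independently over tests and items, each item is included in each test with probability $\nu/k$, where $\nu=\nu_k>0$ is the solution of $(1-\frac{\nu}{k})^k=\frac12$. A test is positive if it contains at least one defective item and negative otherwise. Asymptotics: $p\to+\infty$, with $k=k_p\to+\infty$, $k=o(p)$, and $n=n_p$ such that the rate $R=\log_2\binom{p}{k}/n$ is kept equal (up to integer rounding of $n$) to a fixed constant. A sequence of events $A_p$ holds asymptotically almost surely (a.a.s.) if $\Pr[A_p]\to1$. Let $\mathcal P\subseteq\{1,\dots,n\}$ be the set of indices of positive tests, $n_{\mathrm{pos}}=|\mathcal P|$. An item is potentially defective if it participates in no negative test; let $p'$ be the number of potentially defective items (all $k$ defectives are among them), and identify these items with $\{1,\dots,p'\}$. Let $\theta^*\in\{0,1\}^{p'}$ be the indicator vector of the defective items and, for $i\in\mathcal P$, let $X_i\in\{0,1\}^{p'}$ be the indicator vector of the potentially defective items participating in test $i$. For $\theta\in\{0,1\}^{p'}$ let $H(\theta)=|\{i\in\mathcal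 P:\langle X_i,\theta\rangle=0\}|$ (number of positive tests unexplained by $\theta$). For $\ell\in\{0,\dots,k\}$, $$\phi(\ell)=\min\{H(\theta):\theta\in\{0,1\}^{p'},\ \|\theta\|_0=k,\ \langle\theta,\theta^*\rangle=\ell\},$$ with the minimum over the empty set equal to $+\infty$. First moment function. Let $\alpha(x,y)=x\ln\frac{x}{y}+(1-x)\ln\frac{1-x}{1-y}$ (with $0\ln 0=0$). For $\lambda\in[0,1)$, $F_{p'}(\lambda)$ is the unique number in $[0,1-2^{\lambda-1}]$ satisfying $$\alpha\big(F_{p'}(\lambda),1-2^{\lambda-1}\big)=\frac{\ln\left[\binom{k}{\lfloor\lambda k\rfloor}\binom{p'-k}{\lfloor(1-\lambda)k\rfloor}\right]}{n_{\mathrm{pos}}}.$$ When $\lambda=\ell/k$ the floors are $\ell$ and $k-\ell$. The existence and uniqueness of the values $F_{p'}(\ell/k)$ occurring in the claim is understood as part of the a.a.s. event. (The symbol $\alpha$ for the sparsity exponent in $k=\Theta(p^\alpha)$ is unrelated to the function $\alpha(x,y)$.) *)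

theory Defs
  imports "HOL-Probability.Probability"
begin

text \<open>Items are \<open>{1..p}\<close> and tests are \<open>{1..n}\<close>. An outcome is a pair \<open>(S, A)\<close> of the
  defective set \<open>S\<close> and the design \<open>A\<close>, where \<open>A (i, j)\<close> says that test \<open>i\<close> contains item \<open>j\<close>.\<close>

type_synonym outcome = "nat set \<times> (nat \<times> nat \<Rightarrow> bool)"

text \<open>The bound \<open>\<nu> \<le> k\<close> makes \<open>\<nu> / k\<close> a probability; for even \<open>k\<close> the equation
  has a second root, which is larger than \<open>k\<close>.\<close>

definition nu :: "nat \<Rightarrow> real" where
  "nu k = (THE \<nu>. 0 < \<nu> \<and> \<nu> \<le> real k \<and> (1 - \<nu> / real k) ^ k = 1 / 2)"

lemma nu_ex1:
  assumes "0 < k"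
  shows "\<exists>!\<nu>. 0 < \<nu> \<and> \<nu> \<le> real k \<and> (1 - \<nu> / real k) ^ k = 1 / 2"
proof -
  define r where "r = root k (1 / 2)"
  have r: "0 < r" "r < 1" "r ^ k = 1 / 2"
    using assms by (simp_all add: r_def)
  show ?thesis
  proof (rule ex1I[of _ "real k * (1 - r)"])
    show "0 < real k * (1 - r) \<and> real k * (1 - r) \<le> real k
        \<and> (1 - real k * (1 - r) / real k) ^ k = 1 / 2"
      using assms r by (simp add: mult_le_cancel_left1)
  next
    fix \<nu> assume \<nu>: "0 < \<nu> \<and> \<nu> \<le> real k \<and> (1 - \<nu> / real k) ^ k = 1 / 2"
    then have "0 \<le> 1 - \<nu> / real k" using assms by simp
    with \<nu> r assms have "1 - \<nu> / real k = r"
      by (metis less_imp_le power_eq_imp_eq_base)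
    then show "\<nu> = real k * (1 - r)" using assms by (simp add: field_simps)
  qed
qed

definition gt_pmf :: "nat \<Rightarrow> nat \<Rightarrow> nat \<Rightarrow> outcome pmf" where
  "gt_pmf p k n =
     pair_pmf (pmf_of_set {S. S \<subseteq> {1..p} \<and> card S = k})
              (Pi_pmf ({1..n} \<times> {1..p}) False (\<lambda>_. bernoulli_pmf (nu k / real k)))"

definition aas :: "(nat \<Rightarrow> 'a pmf) \<Rightarrow> (nat \<Rightarrow> 'a \<Rightarrow> bool) \<Rightarrow> bool" where
  "aas M P \<longleftrightarrow> (\<lambda>p. measure_pmf.prob (M p) {\<omega>. P p \<omega>}) \<longlonglongrightarrow> 1"

definition positive_tests :: "nat \<Rightarrow> outcome \<Rightarrow> nat set" where
  "positive_tests n = (\<lambda>(S, A). {i \<in> {1..n}. \<exists>j\<in>S. A (i, j)})"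

definition n_pos :: "nat \<Rightarrow> outcome \<Rightarrow> nat" where
  "n_pos n \<omega> = card (positive_tests n \<omega>)"

definition potential_defectives :: "nat \<Rightarrow> nat \<Rightarrow> outcome \<Rightarrow> nat set" where
  "potential_defectives p n \<omega> =
     {j \<in> {1..p}. \<forall>i \<in> {1..n} - positive_tests n \<omega>. \<not> snd \<omega> (i, j)}"

definition p_rem :: "nat \<Rightarrow> nat \<Rightarrow> outcome \<Rightarrow> nat" where
  "p_rem p n \<omega> = card (potential_defectives p n \<omega>)"

text \<open>Vectors in \<open>{0,1}\<close>-space of dimension \<^term>\<open>p_rem p n \<omega>\<close> are indexed by the potentially
  defective items under their original labels, without renumbering.\<close>

definition binary_vectors :: "'a set \<Rightarrow> ('a \<Rightarrow> nat) set" where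
  "binary_vectors D = D \<rightarrow>\<^sub>E {0, 1}"

definition norm0 :: "'a set \<Rightarrow> ('a \<Rightarrow> nat) \<Rightarrow> nat" where
  "norm0 D \<theta> = card {j \<in> D. \<theta> j \<noteq> 0}"

definition dot :: "'a set \<Rightarrow> ('a \<Rightarrow> nat) \<Rightarrow> ('a \<Rightarrow> nat) \<Rightarrow> nat" where
  "dot D \<theta> \<theta>' = (\<Sum>j\<in>D. \<theta> j * \<theta>' j)"

definition theta_star :: "outcome \<Rightarrow> nat \<Rightarrow> nat" where
  "theta_star \<omega> j = (if j \<in> fst \<omega> then 1 else 0)"

definition X_row :: "outcome \<Rightarrow> nat \<Rightarrow> nat \<Rightarrow> nat" where
  "X_row \<omega> i j = (if snd \<omega> (i, j) then 1 else 0)"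

definition H :: "nat \<Rightarrow> nat \<Rightarrow> outcome \<Rightarrow> (nat \<Rightarrow> nat) \<Rightarrow> nat" where
  "H p n \<omega> \<theta> =
     card {i \<in> positive_tests n \<omega>. dot (potential_defectives p n \<omega>) (X_row \<omega> i) \<theta> = 0}"

text \<open>The infimum is over a finite set, hence a minimum when that set is nonempty;
  in \<^typ>\<open>ereal\<close> the infimum of the empty set is \<open>\<infinity>\<close>.\<close>

definition phi :: "nat \<Rightarrow> nat \<Rightarrow> nat \<Rightarrow> outcome \<Rightarrow> nat \<Rightarrow> ereal" where
  "phi p k n \<omega> l =
     (let D = potential_defectives p n \<omega> in
      INF \<theta> \<in> {\<theta> \<in> binary_vectors D. norm0 D \<theta> = k \<and> dot D \<theta> (theta_star \<omega>) = l}.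
        ereal (real (H p n \<omega> \<theta>)))"

definition alpha_div :: "real \<Rightarrow> real \<Rightarrow> real" where
  "alpha_div x y = x * ln (x / y) + (1 - x) * ln ((1 - x) / (1 - y))"

text \<open>The defining equation of \<open>F\<close> at \<open>lam\<close>, with \<open>p'\<close> written \<open>q\<close> and \<open>n_pos\<close> written \<open>m\<close>.
  The first two conjuncts say that its right-hand side is meaningful; without them
  \<open>ln 0 = 0\<close> and \<open>x / 0 = 0\<close> would supply spurious solutions.\<close>

definition is_F :: "nat \<Rightarrow> nat \<Rightarrow> nat \<Rightarrow> real \<Rightarrow> real \<Rightarrow> bool" where
  "is_F q k m lam x \<longleftrightarrow>
     (let N = (k choose nat \<lfloor>lam * real k\<rfloor>) * ((q - k) choose nat \<lfloor>(1 - lam) * real k\<rfloor>) in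
      0 < m \<and> 0 < N \<and> 0 \<le> x \<and> x \<le> 1 - 2 powr (lam - 1) \<and>
      alpha_div x (1 - 2 powr (lam - 1)) = ln (real N) / real m)"

definition F :: "nat \<Rightarrow> nat \<Rightarrow> nat \<Rightarrow> real \<Rightarrow> real" where
  "F q k m lam = (THE x. is_F q k m lam x)"

end

theory Submission
  imports Defs
begin

text \<open>
  Fix the defective set and condition further on the set of positive tests and on the rows of all
  negative tests; this determines \<open>m = n_pos\<close> and \<open>p'\<close>, while the rows of the positive tests stay
  independent, conditioned only on hitting the defective set. A candidate \<open>\<theta>\<close> with overlap \<open>l\<close> then
  misses each positive test with probability \<open>y = 1 - 2 powr (l / k - 1)\<close>. There are at most \<open>N\<close> such
  candidates, where \<open>m * alpha_div x y = ln N\<close> for \<open>x = F (l / k)\<close>, so the Chernoff bound at level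
  \<open>m * x - C * ln k\<close> with tilt \<open>t = ln (y * (1 - x) / (x * (1 - y)))\<close> and the union bound give
  failure probability at most \<open>k powr (- t * C)\<close>. Since \<open>t \<ge> alpha_div x y = ln N / m\<close>, only a
  positive lower bound on \<open>ln N / m\<close> is needed. That bound, and \<open>ln N / m \<le> (1 - l / k) * ln 2\<close>, which
  makes \<open>F\<close> exist, hold because \<open>p' - k\<close> is about \<open>k * (p / k) powr (1 - 1 / (2 * R))\<close> with high
  probability: the first uses \<open>R > 1 / 2\<close>, the second \<open>R < 1\<close>.
\<close>

section \<open>The first moment function\<close>

text \<open>At \<open>lam = l / k\<close> the products under both floors are integers, so rounding
  loses nothing and the defining equation becomes one between natural binomials.\<close>

lemma is_F_iff:
  fixes d :: nat
  assumes "l < k"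
  defines "N \<equiv> (k choose l) * ((d - k) choose (k - l))" and "y \<equiv> 1 - 2 powr (real l / real k - 1)"
  shows "is_F d k m (real l / real k) x \<longleftrightarrow>
    0 < m \<and> 0 < N \<and> 0 \<le> x \<and> x \<le> y \<and> alpha_div x y = ln (real N) / real m"
proof -
  have "real l / real k * real k = real l" "(1 - real l / real k) * real k = real (k - l)"
    using assms by (simp_all add: of_nat_diff field_simps)
  then have "nat \<lfloor>real l / real k * real k\<rfloor> = l" "nat \<lfloor>(1 - real l / real k) * real k\<rfloor> = k - l"
    by (simp_all only: floor_of_nat nat_int)
  then show ?thesis
    by (simp only: is_F_def N_def y_def Let_def)
qed

text \<open>Continuity at the endpoint \<open>0\<close> is the point: the intermediate value
  argument for \<open>F\<close> runs on the closed interval from \<open>0\<close> to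
  \<open>y\<close>.\<close>

lemma continuous_on_x_ln_x: "continuous_on {0..} (\<lambda>x::real. x * ln x)"
proof -
  have "((\<lambda>x::real. x * ln x) \<longlongrightarrow> 0) (at_right 0)"
  proof -
    \<comment> \<open>Substituting \<open>z = 1 / x\<close> turns \<open>x * ln x\<close> into
      \<open>- ln z / z\<close> with \<open>z\<close> tending to infinity.\<close>
    have "((\<lambda>x::real. - (ln (inverse x) / inverse x)) \<longlongrightarrow> - 0) (at_right 0)"
      by (intro tendsto_minus filterlim_compose[OF ln_x_over_x_tendsto_0 filterlim_inverse_at_top_right])
    moreover have "\<forall>\<^sub>F x::real in at_right 0. - (ln (inverse x) / inverse x) = x * ln x"
      using eventually_at_right_less[of "0::real"]
      by eventually_elim (simp add: ln_inverse divide_inverse)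
    ultimately show ?thesis
      by (simp add: filterlim_cong[OF refl refl])
  qed
  then have "((\<lambda>x::real. x * ln x) \<longlongrightarrow> 0 * ln 0) (at 0 within {0..})"
    by (simp add: at_within_Ici_at_right)
  moreover have "((\<lambda>x::real. x * ln x) \<longlongrightarrow> a * ln a) (at a within {0..})" if "0 < a" for a
    using that by (intro tendsto_intros) auto
  ultimately show ?thesis
    unfolding continuous_on_def by (metis atLeast_iff less_eq_real_def)
qed

text \<open>As a function of \<open>x\<close>, the divergence falls strictly and continuously from
  \<open>- ln (1 - y)\<close> at \<open>0\<close> to \<open>0\<close> at \<open>y\<close>, so each
  level in between is attained exactly once.\<close>

lemma alpha_div_ex1:
  assumes y: "0 < y" "y < 1" and a: "0 \<le> a" "a \<le> - ln (1 - y)"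
  shows "\<exists>!x. 0 \<le> x \<and> x \<le> y \<and> alpha_div x y = a"
proof -
  \<comment> \<open>Splitting the logarithms of quotients isolates \<open>x * ln x\<close>, the only
    summand whose continuity at \<open>0\<close> is delicate.\<close>
  define f where "f x = x * ln x - x * ln y + (1 - x) * ln (1 - x) - (1 - x) * ln (1 - y)" for x :: real
  have f: "alpha_div x y = f x" if "0 \<le> x" "x \<le> y" for x
    using that y by (cases "x = 0") (simp_all add: alpha_div_def f_def ln_div algebra_simps)
  have cont: "continuous_on {0..y} f"
  proof -
    have 1: "continuous_on {0..y} (\<lambda>x. x * ln x)"
      by (rule continuous_on_subset[OF continuous_on_x_ln_x]) auto
    have 2: "continuous_on {0..y} (\<lambda>x. (1 - x) * ln (1 - x))"
      using y by (intro continuous_intros) auto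
    show ?thesis
      unfolding f_def by (intro continuous_on_add continuous_on_diff 1 2) (intro continuous_intros)+
  qed
  have decreasing: "f x2 < f x1" if "0 \<le> x1" "x1 < x2" "x2 \<le> y" for x1 x2
  proof (rule DERIV_neg_imp_decreasing_open[OF \<open>x1 < x2\<close>])
    fix x assume x: "x1 < x" "x < x2"
    then have x': "0 < x" "x < y" "x < 1"
      using that y by auto
    have 1: "((\<lambda>x. x * ln x) has_real_derivative ln x + 1) (at x)"
      using x' by (auto intro!: derivative_eq_intros)
    have 2: "((\<lambda>x. (1 - x) * ln (1 - x)) has_real_derivative - ln (1 - x) - 1) (at x)"
      using x' by (auto intro!: derivative_eq_intros)
    \<comment> \<open>The derivative is the logarithm of the odds ratio of \<open>x\<close> against
      \<open>y\<close>, which is negative for \<open>x < y\<close>.\<close>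
    have "(f has_real_derivative ln x - ln y - ln (1 - x) + ln (1 - y)) (at x)"
      unfolding f_def by (rule derivative_eq_intros 1 2 refl)+ simp
    moreover have "ln x < ln y" "ln (1 - y) < ln (1 - x)"
      using x' y by auto
    ultimately show "\<exists>d. (f has_real_derivative d) (at x) \<and> d < 0"
      by (intro exI[of _ "ln x - ln y - ln (1 - x) + ln (1 - y)"]) auto
  qed (rule continuous_on_subset[OF cont], use that in auto)
  have "f 0 = - ln (1 - y)" "f y = 0"
    by (simp_all add: f_def)
  then obtain x where x: "0 \<le> x" "x \<le> y" "f x = a"
    using IVT2'[of f y a 0] cont y a by auto
  show ?thesis
  proof (rule ex1I[of _ x])
    show "0 \<le> x \<and> x \<le> y \<and> alpha_div x y = a"
      using x f[of x] by simp
  next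
    fix x' assume x': "0 \<le> x' \<and> x' \<le> y \<and> alpha_div x' y = a"
    then have "f x' = a"
      using f[of x'] by simp
    then show "x' = x"
      using x x' decreasing[of x x'] decreasing[of x' x] by (cases x x' rule: linorder_cases) auto
  qed
qed

text \<open>The hypothesis \<open>le\<close> says that the prescribed level does not exceed the
  divergence at \<open>x = 0\<close>, which for this \<open>y\<close> equals
  \<open>(1 - l / k) * ln 2\<close>.\<close>

lemma is_F_ex1:
  assumes l: "l < k" and m: "0 < m"
    and N: "0 < (k choose l) * ((d - k) choose (k - l))"
    and le: "ln (real ((k choose l) * ((d - k) choose (k - l)))) \<le> real m * (1 - real l / real k) * ln 2"
  shows "\<exists>!x. is_F d k m (real l / real k) x"
proof -
  let ?N = "(k choose l) * ((d - k) choose (k - l))"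
  let ?y = "1 - 2 powr (real l / real k - 1)"
  have "- ln (1 - ?y) = (1 - real l / real k) * ln 2"
    by (simp add: ln_powr algebra_simps)
  moreover have "ln (real ?N) / real m \<le> (1 - real l / real k) * ln 2"
    using le m by (simp add: field_simps)
  moreover have "0 \<le> ln (real ?N) / real m"
  proof (intro divide_nonneg_nonneg ln_ge_zero)
    show "1 \<le> real ?N"
      using N by (simp only: real_of_nat_ge_one_iff Suc_le_eq One_nat_def)
  qed simp
  moreover have "0 < ?y" "?y < 1"
    using l by (simp_all add: powr_less_one)
  ultimately have "\<exists>!x. 0 \<le> x \<and> x \<le> ?y \<and> alpha_div x ?y = ln (real ?N) / real m"
    by (intro alpha_div_ex1) auto
  then show ?thesis
    using l m N by (simp add: is_F_iff)
qed

text \<open>This \<open>t\<close> is the optimal tilt for a binomial lower tail at level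
  \<open>m * x\<close>: it turns the moment generating factor \<open>1 - y + y * exp (- t)\<close>
  into \<open>(1 - y) / (1 - x)\<close>, and the exponents then collect into the divergence.\<close>

lemma chernoff_tilt:
  fixes x y :: real
  assumes "0 < x" "x < 1" "0 < y" "y < 1"
  defines "t \<equiv> ln (y * (1 - x) / (x * (1 - y)))"
  shows "exp (t * (real m * x)) * (1 - y + y * exp (- t)) ^ m = exp (- real m * alpha_div x y)"
proof -
  have t: "t = ln (y / x) + ln ((1 - x) / (1 - y))"
    unfolding t_def using assms(1-4) by (simp add: ln_div ln_mult)
  have "exp (- t) = x * (1 - y) / (y * (1 - x))"
    unfolding t_def using assms by (simp add: exp_minus)
  then have "1 - y + y * exp (- t) = (1 - y) / (1 - x)"
    using assms by (simp add: field_simps)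
  also have "\<dots> = exp (- ln ((1 - x) / (1 - y)))"
    using assms by (simp add: exp_minus)
  finally have "exp (t * (real m * x)) * (1 - y + y * exp (- t)) ^ m =
      exp (t * (real m * x) + real m * (- ln ((1 - x) / (1 - y))))"
    by (simp only: exp_of_nat_mult exp_add)
  also have "t * (real m * x) + real m * (- ln ((1 - x) / (1 - y))) = - real m * alpha_div x y"
    using assms(1-4) unfolding t alpha_div_def by (simp add: ln_div algebra_simps)
  finally show ?thesis .
qed

text \<open>With \<open>u = ln (y / x)\<close> and \<open>v = ln ((1 - x) / (1 - y))\<close>, both
  nonnegative, the divergence is \<open>(1 - x) * v - x * u\<close> while the tilt is
  \<open>u + v\<close>. This bounds the tilt from below without locating \<open>x\<close>.\<close>

lemma alpha_div_le_tilt: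
  fixes x y :: real
  assumes "0 < x" "x \<le> y" "y < 1"
  shows "alpha_div x y \<le> ln (y * (1 - x) / (x * (1 - y)))"
proof -
  have t: "ln (y * (1 - x) / (x * (1 - y))) = ln (y / x) + ln ((1 - x) / (1 - y))"
    using assms by (simp add: ln_div ln_mult)
  have nonneg: "0 \<le> ln (y / x)" "0 \<le> ln ((1 - x) / (1 - y))"
    using assms by (auto intro!: ln_ge_zero)
  have "x * ln (x / y) = - (x * ln (y / x))"
    using assms by (simp add: ln_div algebra_simps)
  moreover have "0 \<le> x * ln (y / x)"
    using assms nonneg by simp
  moreover have "(1 - x) * ln ((1 - x) / (1 - y)) \<le> 1 * ln ((1 - x) / (1 - y))"
    using assms nonneg by (intro mult_right_mono) auto
  ultimately show ?thesis
    unfolding t alpha_div_def using nonneg(1) by linarith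
qed

section \<open>Products of independent rows\<close>

lemma finite_set_Pi_pmf:
  assumes "finite I" "\<And>i. i \<in> I \<Longrightarrow> finite (set_pmf (M i))"
  shows "finite (set_pmf (Pi_pmf I d M))"
  using assms by (simp add: set_Pi_pmf finite_PiE_dflt)

text \<open>Currying identifies a matrix of independent entries with a family of independent rows;
  the mass functions agree because a double product over rows and columns is a product over
  pairs.\<close>

lemma Pi_pmf_Times:
  assumes "finite I" "finite J"
  shows "Pi_pmf (I \<times> J) d (\<lambda>_. M) =
    map_pmf (\<lambda>f x. f (fst x) (snd x)) (Pi_pmf I (\<lambda>_. d) (\<lambda>_. Pi_pmf J d (\<lambda>_. M)))"
proof (rule pmf_eqI)
  fix x :: "'a \<times> 'b \<Rightarrow> 'c"
  let ?F = "\<lambda>(f :: 'a \<Rightarrow> 'b \<Rightarrow> 'c) x. f (fst x) (snd x)"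
  let ?Q = "Pi_pmf I (\<lambda>_. d) (\<lambda>_. Pi_pmf J d (\<lambda>_. M))"
  have inj: "inj ?F"
    by (intro injI ext) (metis fst_conv snd_conv)
  have "x = ?F (curry x)"
    by (auto simp: fun_eq_iff)
  then have "pmf (map_pmf ?F ?Q) x = pmf (map_pmf ?F ?Q) (?F (curry x))"
    by simp
  also have "\<dots> = pmf ?Q (curry x)"
    using inj by (rule pmf_map_inj')
  also have "\<dots> = pmf (Pi_pmf (I \<times> J) d (\<lambda>_. M)) x"
  proof (cases "\<forall>z. z \<notin> I \<times> J \<longrightarrow> x z = d")
    case True
    then have "pmf ?Q (curry x) = (\<Prod>i\<in>I. \<Prod>j\<in>J. pmf M (x (i, j)))"
      using assms by (auto simp: pmf_Pi fun_eq_iff)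
    also have "\<dots> = (\<Prod>z\<in>I \<times> J. pmf M (x z))"
      by (simp add: prod.cartesian_product case_prod_unfold)
    finally show ?thesis
      using True assms by (simp add: pmf_Pi)
  next
    case False
    \<comment> \<open>A non-default entry outside the grid has mass zero on both sides: inside row
      \<open>i\<close> if \<open>i \<in> I\<close>, and otherwise because row \<open>i\<close>
      differs from the default row.\<close>
    then obtain i j where ij: "(i, j) \<notin> I \<times> J" "x (i, j) \<noteq> d"
      by auto
    have "pmf ?Q (curry x) = 0"
    proof (cases "i \<in> I")
      case True
      then have "pmf (Pi_pmf J d (\<lambda>_. M)) (curry x i) = 0"
        using ij assms by (intro pmf_Pi_outside) auto
      then have "(\<Prod>i\<in>I. pmf (Pi_pmf J d (\<lambda>_. M)) (curry x i)) = 0"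
        using assms True by (intro prod_zero) auto
      then show ?thesis
        using assms(1) by (subst pmf_Pi) auto
    next
      case False
      then show ?thesis
        using ij assms by (intro pmf_Pi_outside) (auto simp: fun_eq_iff)
    qed
    then show ?thesis
      using False assms by (auto simp: pmf_Pi)
  qed
  finally show "pmf (Pi_pmf (I \<times> J) d (\<lambda>_. M)) x = pmf (map_pmf ?F ?Q) x"
    by simp
qed

lemma expectation_prod_rows:
  fixes g :: "'a \<Rightarrow> ('b \<Rightarrow> 'c) \<Rightarrow> real"
  assumes "finite I" "finite J" "finite (set_pmf M)" "\<And>i r. i \<in> I \<Longrightarrow> 0 \<le> g i r"
  shows "measure_pmf.expectation (Pi_pmf (I \<times> J) d (\<lambda>_. M)) (\<lambda>A. \<Prod>i\<in>I. g i (\<lambda>j. A (i, j))) =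
    (\<Prod>i\<in>I. measure_pmf.expectation (Pi_pmf J d (\<lambda>_. M)) (g i))"
proof -
  have "measure_pmf.expectation (Pi_pmf (I \<times> J) d (\<lambda>_. M)) (\<lambda>A. \<Prod>i\<in>I. g i (\<lambda>j. A (i, j))) =
    measure_pmf.expectation (Pi_pmf I (\<lambda>_. d) (\<lambda>_. Pi_pmf J d (\<lambda>_. M))) (\<lambda>f. \<Prod>i\<in>I. g i (f i))"
    using assms by (simp add: Pi_pmf_Times)
  also have "\<dots> = (\<Prod>i\<in>I. measure_pmf.expectation (Pi_pmf J d (\<lambda>_. M)) (g i))"
    using assms
    by (intro expectation_prod_Pi_pmf integrable_measure_pmf_finite finite_set_Pi_pmf) auto
  finally show ?thesis .
qed

lemma prob_rows:
  assumes "finite I" "finite J"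
  shows "measure_pmf.prob (Pi_pmf (I \<times> J) d (\<lambda>_. M)) {A. \<forall>i\<in>I. (\<lambda>j. A (i, j)) \<in> Q i} =
    (\<Prod>i\<in>I. measure_pmf.prob (Pi_pmf J d (\<lambda>_. M)) (Q i))"
proof -
  have "(\<lambda>f x. f (fst x) (snd x)) -` {A. \<forall>i\<in>I. (\<lambda>j. A (i, j)) \<in> Q i} = Pi I Q"
    by auto
  then show ?thesis
    using assms by (simp add: Pi_pmf_Times measure_Pi_pmf_Pi)
qed

text \<open>This is the law of total probability over the values of \<open>\<Phi>\<close>. Bounding
  joint instead of conditional probabilities avoids division by the probability of a null
  cell.\<close>

lemma prob_le_by_cells:
  assumes "finite (set_pmf M)" "0 \<le> b"
    and cell: "\<And>c. measure_pmf.prob M {x \<in> E. \<Phi> x = c} \<le> b * measure_pmf.prob M {x. \<Phi> x = c}"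
  shows "measure_pmf.prob M E \<le> b"
proof -
  let ?C = "\<Phi> ` set_pmf M"
  have fin: "finite ?C"
    using assms by simp
  have "measure_pmf.prob M E = measure_pmf.prob M (E \<inter> set_pmf M)"
    by (simp add: measure_Int_set_pmf)
  also have "\<dots> \<le> measure_pmf.prob M (\<Union>c\<in>?C. {x \<in> E. \<Phi> x = c})"
    by (intro measure_pmf.finite_measure_mono) auto
  also have "\<dots> \<le> (\<Sum>c\<in>?C. measure_pmf.prob M {x \<in> E. \<Phi> x = c})"
    using fin by (intro measure_pmf.finite_measure_subadditive_finite) auto
  also have "\<dots> \<le> (\<Sum>c\<in>?C. b * pmf (map_pmf \<Phi> M) c)"
    using cell by (intro sum_mono) (simp add: pmf_map vimage_def)
  also have "\<dots> = b * measure_pmf.prob (map_pmf \<Phi> M) ?C"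
    using fin by (simp only: sum_distrib_left[symmetric] measure_measure_pmf_finite)
  also have "\<dots> \<le> b * 1"
    using assms by (intro mult_left_mono) auto
  finally show ?thesis
    by simp
qed

text \<open>Integrating out the first component reduces the random defective set to a fixed
  one.\<close>

lemma prob_pair_pmf_le:
  assumes "0 \<le> b" "\<And>x. x \<in> set_pmf M \<Longrightarrow> measure_pmf.prob N {y. (x, y) \<in> E} \<le> b"
  shows "measure_pmf.prob (pair_pmf M N) E \<le> b"
proof -
  have "emeasure (measure_pmf (pair_pmf M N)) E = (\<integral>\<^sup>+x. \<integral>\<^sup>+y. indicator E (x, y) \<partial>N \<partial>M)"
    by (subst nn_integral_pair_pmf'[symmetric]) simp
  also have "\<dots> = (\<integral>\<^sup>+x. emeasure (measure_pmf N) {y. (x, y) \<in> E} \<partial>M)"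
  proof -
    have "(\<integral>\<^sup>+y. indicator E (x, y) \<partial>N) = emeasure (measure_pmf N) {y. (x, y) \<in> E}" for x
      by (subst nn_integral_indicator[symmetric])
        (auto simp del: nn_integral_indicator simp: indicator_def intro!: nn_integral_cong)
    then show ?thesis
      by simp
  qed
  also have "\<dots> \<le> (\<integral>\<^sup>+x. ennreal b \<partial>M)"
    using assms
    by (intro nn_integral_mono_AE) (auto simp: AE_measure_pmf_iff measure_pmf.emeasure_eq_measure)
  also have "\<dots> = ennreal b"
    by simp
  finally show ?thesis
    using assms(1) by (simp add: measure_pmf.emeasure_eq_measure)
qed

lemma prob_Pi_bernoulli_misses:
  fixes p :: nat
  assumes "U \<subseteq> {1..p}" "0 \<le> q" "q \<le> 1"
  shows "measure_pmf.prob (Pi_pmf {1..p} False (\<lambda>_. bernoulli_pmf q)) {r. \<forall>j\<in>U. \<not> r j} =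
    (1 - q) ^ card U"
proof -
  have eq: "{r. \<forall>j\<in>U. \<not> r j} = Pi {1..p} (\<lambda>j. if j \<in> U then {False} else UNIV)"
    using assms by (force simp: Pi_def split: if_splits)
  have "measure_pmf.prob (Pi_pmf {1..p} False (\<lambda>_. bernoulli_pmf q)) {r. \<forall>j\<in>U. \<not> r j} =
    (\<Prod>j\<in>{1..p}. if j \<in> U then 1 - q else 1)"
    unfolding eq using assms
    by (subst measure_Pi_pmf_Pi) (auto intro!: prod.cong simp: measure_pmf_single)
  also have "\<dots> = (1 - q) ^ card U"
    using assms by (simp add: prod.If_cases Int_absorb1)
  finally show ?thesis .
qed

section \<open>Positive tests and potentially defective items\<close>

definition misses :: "'a set \<Rightarrow> ('a \<Rightarrow> bool) set" where
  "misses U = {r. \<forall>j\<in>U. \<not> r j}"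

definition hits :: "'a set \<Rightarrow> ('a \<Rightarrow> bool) set" where
  "hits U = {r. \<exists>j\<in>U. r j}"

text \<open>The parameter \<open>q\<close> stands for \<open>nu k / k\<close>. All that is kept of
  \<open>nu\<close> is that \<open>q\<close> is a probability for which a test misses
  \<open>k\<close> given items with probability one half.\<close>

locale fixed_defectives =
  fixes p k n :: nat and q :: real and S :: "nat set"
  assumes k_pos: "0 < k"
    and S_subset: "S \<subseteq> {1..p}"
    and card_S: "card S = k"
    and q_nonneg: "0 \<le> q" and q_le_1: "q \<le> 1"
    and half: "(1 - q) ^ k = 1 / 2"
begin

definition row_pmf :: "(nat \<Rightarrow> bool) pmf" where
  "row_pmf = Pi_pmf {1..p} False (\<lambda>_. bernoulli_pmf q)"

definition design_pmf :: "(nat \<times> nat \<Rightarrow> bool) pmf" where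
  "design_pmf = Pi_pmf ({1..n} \<times> {1..p}) False (\<lambda>_. bernoulli_pmf q)"

lemma finite_row_pmf: "finite (set_pmf row_pmf)"
  unfolding row_pmf_def by (intro finite_set_Pi_pmf) auto

lemma finite_design_pmf: "finite (set_pmf design_pmf)"
  unfolding design_pmf_def by (intro finite_set_Pi_pmf) auto

lemma finite_S: "finite S"
  using S_subset finite_subset by blast

lemma q_less_1: "q < 1"
proof -
  have "q \<noteq> 1"
    using half k_pos by (auto simp: power_0_left)
  then show ?thesis
    using q_le_1 by simp
qed

text \<open>Since \<open>1 - q\<close> is exactly the \<open>k\<close>-th root of
  \<open>1 / 2\<close>, miss probabilities are exact powers of two, in the form in which they enter
  the definition of \<open>F\<close>.\<close>

lemma power_miss_eq_powr: "(1 - q) ^ j = 2 powr - (real j / real k)"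
proof -
  have "(2 powr - (1 / real k)) ^ k = (1 - q) ^ k"
    using k_pos half by (simp add: powr_realpow[symmetric] powr_powr powr_minus field_simps)
  then have "1 - q = 2 powr - (1 / real k)"
    using k_pos q_le_1 by (metis diff_ge_0_iff_ge power_eq_imp_eq_base powr_ge_zero)
  then show ?thesis
    by (simp add: powr_realpow[symmetric] powr_powr)
qed

lemma prob_row_misses: "U \<subseteq> {1..p} \<Longrightarrow> measure_pmf.prob row_pmf (misses U) = (1 - q) ^ card U"
  unfolding row_pmf_def misses_def by (rule prob_Pi_bernoulli_misses[OF _ q_nonneg q_le_1])

lemma prob_row_hits: "measure_pmf.prob row_pmf (hits S) = 1 / 2"
proof -
  have "hits S = UNIV - misses S"
    by (auto simp: hits_def misses_def)
  then have "measure_pmf.prob row_pmf (hits S) = 1 - measure_pmf.prob row_pmf (misses S)"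
    by (metis measure_pmf.prob_compl sets_measure_pmf space_measure_pmf UNIV_I)
  then show ?thesis
    using prob_row_misses[OF S_subset] half card_S by simp
qed

lemma positive_tests_eq: "positive_tests n (S, A) = {i \<in> {1..n}. (\<lambda>j. A (i, j)) \<in> hits S}"
  by (auto simp: positive_tests_def hits_def)

lemma prob_design_rows:
  "measure_pmf.prob design_pmf {A. \<forall>i\<in>{1..n}. (\<lambda>j. A (i, j)) \<in> Q i} =
    (\<Prod>i\<in>{1..n}. measure_pmf.prob row_pmf (Q i))"
  unfolding design_pmf_def row_pmf_def by (rule prob_rows) auto

text \<open>The event is one condition per row: rows in \<open>P\<close> hit \<open>S\<close>, all
  others miss \<open>S \<union> U\<close>. Hence every positive set is equally likely, and given
  \<open>P\<close> the nondefective items stay potentially defective independently, each with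
  probability \<open>(1 - q) ^ (n - card P)\<close>.\<close>

lemma prob_positive_tests_eq_and_cleared:
  assumes P: "P \<subseteq> {1..n}" and U: "U \<subseteq> {1..p} - S"
  shows "measure_pmf.prob design_pmf
      {A. positive_tests n (S, A) = P \<and> U \<subseteq> potential_defectives p n (S, A)} =
    (1 / 2) ^ n * ((1 - q) ^ (n - card P)) ^ card U"
proof -
  let ?Q = "\<lambda>i. if i \<in> P then hits S else misses (S \<union> U)"
  have fin: "finite P" "finite U"
    using P U finite_subset by blast+
  have "{A. positive_tests n (S, A) = P \<and> U \<subseteq> potential_defectives p n (S, A)} =
      {A. \<forall>i\<in>{1..n}. (\<lambda>j. A (i, j)) \<in> ?Q i}"
  proof (intro Collect_cong iffI conjI)
    fix A assume A: "\<forall>i\<in>{1..n}. (\<lambda>j. A (i, j)) \<in> ?Q i"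
    then have "(\<lambda>j. A (i, j)) \<in> hits S \<longleftrightarrow> i \<in> P" if "i \<in> {1..n}" for i
      using that by (fastforce simp: hits_def misses_def split: if_splits)
    then show eq: "positive_tests n (S, A) = P"
      using P by (auto simp: positive_tests_eq)
    have "\<not> A (i, j)" if "j \<in> U" "i \<in> {1..n}" "i \<notin> P" for i j
      using bspec[OF A, of i] that by (auto simp: misses_def)
    then show "U \<subseteq> potential_defectives p n (S, A)"
      using U by (auto simp: potential_defectives_def eq)
  next
    fix A assume A: "positive_tests n (S, A) = P \<and> U \<subseteq> potential_defectives p n (S, A)"
    then have "(\<lambda>j. A (i, j)) \<in> hits S \<longleftrightarrow> i \<in> P" if "i \<in> {1..n}" for i
      using that by (auto simp: positive_tests_eq)
    moreover have "\<not> A (i, j)" if "j \<in> U" "i \<in> {1..n}" "i \<notin> P" for i j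
      using A that by (auto simp: potential_defectives_def)
    ultimately show "\<forall>i\<in>{1..n}. (\<lambda>j. A (i, j)) \<in> ?Q i"
      by (simp only: misses_def hits_def split: if_splits) blast
  qed
  then have "measure_pmf.prob design_pmf
      {A. positive_tests n (S, A) = P \<and> U \<subseteq> potential_defectives p n (S, A)} =
      (\<Prod>i\<in>{1..n}. measure_pmf.prob row_pmf (?Q i))"
    by (simp only: prob_design_rows)
  also have "\<dots> = (\<Prod>i\<in>{1..n}. if i \<in> P then 1 / 2 else 1 / 2 * (1 - q) ^ card U)"
  proof (intro prod.cong refl)
    fix i
    have "card (S \<union> U) = k + card U"
      using U fin finite_S card_S by (subst card_Un_disjoint) auto
    then have "measure_pmf.prob row_pmf (misses (S \<union> U)) = 1 / 2 * (1 - q) ^ card U"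
      using U S_subset half by (subst prob_row_misses) (auto simp: power_add)
    then show "measure_pmf.prob row_pmf (?Q i) =
        (if i \<in> P then 1 / 2 else 1 / 2 * (1 - q) ^ card U)"
      by (simp add: prob_row_hits)
  qed
  also have "\<dots> = (1 / 2) ^ card P * (1 / 2 * (1 - q) ^ card U) ^ (n - card P)"
  proof -
    have "{1..n} \<inter> - {i. i \<in> P} = {1..n} - P"
      by auto
    then show ?thesis
      using P fin by (simp add: prod.If_cases Int_absorb1 card_Diff_subset)
  qed
  also have "\<dots> = (1 / 2) ^ (card P + (n - card P)) * ((1 - q) ^ (n - card P)) ^ card U"
    by (simp add: power_mult_distrib power_divide power_add power_mult[symmetric] mult.commute)
  also have "card P + (n - card P) = n"
    using P card_mono[of "{1..n}" P] by simp
  finally show ?thesis .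
qed

lemma prob_positive_tests_eq:
  assumes "P \<subseteq> {1..n}"
  shows "measure_pmf.prob design_pmf {A. positive_tests n (S, A) = P} = (1 / 2) ^ n"
  using prob_positive_tests_eq_and_cleared[OF assms, of "{}"] by simp

text \<open>Whether a row hits \<open>S\<close> is a fair coin, so \<open>n_pos\<close> is binomial
  and Hoeffding's inequality applies.\<close>

lemma n_pos_tail:
  fixes \<eta> :: real
  assumes "0 \<le> \<eta>" "0 < n"
  shows "measure_pmf.prob design_pmf {A. \<eta> * n \<le> \<bar>real (n_pos n (S, A)) - n / 2\<bar>} \<le>
    2 * exp (- 2 * real n * \<eta>\<^sup>2)"
proof -
  let ?W = "Pi_pmf {1..n} (\<lambda>_. False) (\<lambda>_. row_pmf)"
  let ?h = "\<lambda>r. r \<in> hits S"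
  have "map_pmf ?h row_pmf = bernoulli_pmf (1 / 2)"
  proof (rule pmf_eqI)
    fix b
    have "?h -` {True} = hits S" "?h -` {False} = misses S"
      by (auto simp: hits_def misses_def)
    then show "pmf (map_pmf ?h row_pmf) b = pmf (bernoulli_pmf (1 / 2)) b"
      using prob_row_hits prob_row_misses[OF S_subset] half card_S by (cases b) (simp_all add: pmf_map)
  qed
  then have "map_pmf (\<lambda>f. ?h \<circ> f) ?W = Pi_pmf {1..n} False (\<lambda>_. bernoulli_pmf (1 / 2))"
    by (subst Pi_pmf_map[symmetric, where dflt' = False]) (auto simp: hits_def)
  then have W: "Pi_pmf {1..n} False (\<lambda>_. bernoulli_pmf (1 / 2)) = map_pmf (\<lambda>f. ?h \<circ> f) ?W"
    by simp
  have binom: "binomial_pmf n (1 / 2) = map_pmf (\<lambda>f. card {i \<in> {1..n}. f i \<in> hits S}) ?W"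
    by (subst binomial_pmf_altdef'[of "{1..n}" n "1 / 2" False])
      (simp_all only: W finite_atLeastAtMost card_atLeastAtMost diff_Suc_1 pmf.map_comp,
        simp_all add: o_def)
  have "map_pmf (\<lambda>A. n_pos n (S, A)) design_pmf = binomial_pmf n (1 / 2)"
    unfolding binom design_pmf_def row_pmf_def
    by (subst Pi_pmf_Times) (auto simp: pmf.map_comp o_def n_pos_def positive_tests_eq)
  then have "measure_pmf.prob design_pmf {A. \<eta> * n \<le> \<bar>real (n_pos n (S, A)) - n / 2\<bar>} =
      measure_pmf.prob (binomial_pmf n (1 / 2)) {x. \<eta> * n \<le> \<bar>real x - n * (1 / 2)\<bar>}"
    by (simp flip: \<open>map_pmf (\<lambda>A. n_pos n (S, A)) design_pmf = _\<close>)
  also have "\<dots> \<le> 2 * exp (- 2 * (\<eta> * n)\<^sup>2 / n)"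
    using assms
    by (intro binomial_distribution.prob_abs_ge) (auto simp: binomial_distribution_def)
  also have "- 2 * (\<eta> * n)\<^sup>2 / n = - 2 * real n * \<eta>\<^sup>2"
    using assms by (simp add: power2_eq_square)
  finally show ?thesis .
qed

text \<open>This is Chebyshev's inequality given the positive set \<open>P\<close>: the number of
  surviving nondefective items has conditional mean \<open>\<mu>\<close> and conditional variance at
  most \<open>\<mu>\<close>, and \<open>\<mu> / (\<mu> / 2)\<^sup>2\<close> is
  \<open>4 / \<mu>\<close>.\<close>

lemma potential_defectives_tail:
  assumes P: "P \<subseteq> {1..n}" and p: "k < p"
  defines "\<mu> \<equiv> real (p - k) * (1 - q) ^ (n - card P)"
  shows "measure_pmf.prob design_pmf {A. positive_tests n (S, A) = P \<and>
      \<mu> / 2 < \<bar>real (card (potential_defectives p n (S, A) - S)) - \<mu>\<bar>} \<le>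
    4 / \<mu> * measure_pmf.prob design_pmf {A. positive_tests n (S, A) = P}"
proof -
  define v where "v = (1 - q) ^ (n - card P)"
  \<comment> \<open>The factor \<open>c\<close> carries the conditioning: expectations weighted by
    it are conditional expectations times the probability of \<open>P\<close>.\<close>
  define c :: "(nat \<times> nat \<Rightarrow> bool) \<Rightarrow> real" where
    "c A = of_bool (positive_tests n (S, A) = P)" for A
  define I :: "nat \<Rightarrow> (nat \<times> nat \<Rightarrow> bool) \<Rightarrow> real" where
    "I j A = of_bool (j \<in> potential_defectives p n (S, A))" for j A
  define Z where "Z A = real (card (potential_defectives p n (S, A) - S))" for A
  let ?N = "{1..p} - S"
  let ?E = "measure_pmf.expectation design_pmf"
  note int = integrable_measure_pmf_finite[OF finite_design_pmf]
  have v: "0 < v"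
    unfolding v_def using q_less_1 by simp
  have card_N: "card ?N = p - k"
    using S_subset finite_S card_S by (subst card_Diff_subset) auto
  have \<mu>: "\<mu> = real (card ?N) * v" "0 < \<mu>"
    using v p unfolding \<mu>_def v_def card_N by simp_all
  have Ec: "?E (\<lambda>A. c A * (\<Prod>j\<in>U. I j A)) = (1 / 2) ^ n * v ^ card U" if "U \<subseteq> ?N" for U
  proof -
    have finU: "finite U"
      using that finite_subset by blast
    have "c A * (\<Prod>j\<in>U. I j A) = indicator
        {A. positive_tests n (S, A) = P \<and> U \<subseteq> potential_defectives p n (S, A)} A" for A
      using finU by (auto simp: c_def I_def indicator_def subset_eq)
    then show ?thesis
      using prob_positive_tests_eq_and_cleared[OF P that] by (simp add: v_def)
  qed
  have lin: "?E (\<lambda>A. f A - a * g A - a * h A + b * u A) = ?E f - a * ?E g - a * ?E h + b * ?E u"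
    for f g h u :: "(nat \<times> nat \<Rightarrow> bool) \<Rightarrow> real" and a b
    by (simp add: int)
  have cov: "?E (\<lambda>A. c A * ((I i A - v) * (I j A - v))) \<le> (if i = j then (1 / 2) ^ n * v else 0)"
    if ij: "i \<in> ?N" "j \<in> ?N" for i j
  proof -
    have "I i A * I j A = (\<Prod>h\<in>{i, j}. I h A)" for A
      by (cases "i = j") (auto simp: I_def)
    then have pair: "(\<Prod>h\<in>{i, j}. I h A) = I i A * I j A" for A
      by simp
    \<comment> \<open>The singleton and empty products are kept as products over index sets, so that
      \<open>Ec\<close> evaluates all four terms.\<close>
    have "c A * ((I i A - v) * (I j A - v)) =
      c A * (\<Prod>h\<in>{i, j}. I h A) - v * (c A * (\<Prod>h\<in>{i}. I h A)) - v * (c A * (\<Prod>h\<in>{j}. I h A))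
        + v\<^sup>2 * (c A * (\<Prod>h\<in>{}. I h A))" for A
      unfolding pair by (simp add: algebra_simps power2_eq_square)
    then have "?E (\<lambda>A. c A * ((I i A - v) * (I j A - v))) =
      ?E (\<lambda>A. c A * (\<Prod>h\<in>{i, j}. I h A)) - v * ?E (\<lambda>A. c A * (\<Prod>h\<in>{i}. I h A))
        - v * ?E (\<lambda>A. c A * (\<Prod>h\<in>{j}. I h A)) + v\<^sup>2 * ?E (\<lambda>A. c A * (\<Prod>h\<in>{}. I h A))"
      by (simp only: lin)
    \<comment> \<open>For \<open>i \<noteq> j\<close> the set \<open>{i, j}\<close> has two elements
      and the covariance vanishes; on the diagonal \<open>v - v\<^sup>2\<close> is at most
      \<open>v\<close>.\<close>
    also have "\<dots> = (1 / 2) ^ n * (v ^ card {i, j} - v\<^sup>2)"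
      using ij by (simp only: Ec insert_subset empty_subsetI simp_thms)
        (simp add: algebra_simps power2_eq_square)
    also have "\<dots> \<le> (if i = j then (1 / 2) ^ n * v else 0)"
      by (auto simp: power2_eq_square)
    finally show ?thesis .
  qed
  have Z: "Z A - \<mu> = (\<Sum>j\<in>?N. I j A - v)" for A
  proof -
    have "potential_defectives p n (S, A) - S = {j \<in> ?N. j \<in> potential_defectives p n (S, A)}"
      by (auto simp: potential_defectives_def)
    then have "Z A = (\<Sum>j\<in>?N. I j A)"
      by (simp add: Z_def I_def sum.If_cases of_bool_def Int_def)
    then show ?thesis
      by (simp add: \<mu> sum_subtractf)
  qed
  have "?E (\<lambda>A. c A * (Z A - \<mu>)\<^sup>2) =
      ?E (\<lambda>A. \<Sum>i\<in>?N. \<Sum>j\<in>?N. c A * ((I i A - v) * (I j A - v)))"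
    unfolding Z power2_eq_square sum_product by (simp only: sum_distrib_left)
  also have "\<dots> = (\<Sum>i\<in>?N. \<Sum>j\<in>?N. ?E (\<lambda>A. c A * ((I i A - v) * (I j A - v))))"
    using int by (subst Bochner_Integration.integral_sum) (auto intro!: sum.cong Bochner_Integration.integral_sum)
  also have "\<dots> \<le> (\<Sum>i\<in>?N. \<Sum>j\<in>?N. if i = j then (1 / 2) ^ n * v else 0)"
    using cov by (intro sum_mono) auto
  also have "\<dots> = (1 / 2) ^ n * \<mu>"
    by (simp add: \<mu>)
  finally have second_moment: "?E (\<lambda>A. c A * (Z A - \<mu>)\<^sup>2) \<le> (1 / 2) ^ n * \<mu>" .
  have "measure_pmf.prob design_pmf {A. positive_tests n (S, A) = P \<and> \<mu> / 2 < \<bar>Z A - \<mu>\<bar>} =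
      ?E (indicator {A. positive_tests n (S, A) = P \<and> \<mu> / 2 < \<bar>Z A - \<mu>\<bar>})"
    by simp
  also have "\<dots> \<le> ?E (\<lambda>A. c A * (Z A - \<mu>)\<^sup>2 * (4 / \<mu>\<^sup>2))"
  proof (intro integral_mono int)
    fix A
    have "1 \<le> (Z A - \<mu>)\<^sup>2 * (4 / \<mu>\<^sup>2)" if "\<mu> / 2 < \<bar>Z A - \<mu>\<bar>"
    proof -
      have "(\<mu> / 2)\<^sup>2 \<le> \<bar>Z A - \<mu>\<bar>\<^sup>2"
        using that \<mu>(2) by (intro power_mono) auto
      then show ?thesis
        using \<mu>(2) by (simp add: field_simps)
    qed
    then show "indicator {A. positive_tests n (S, A) = P \<and> \<mu> / 2 < \<bar>Z A - \<mu>\<bar>} A \<le>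
        c A * (Z A - \<mu>)\<^sup>2 * (4 / \<mu>\<^sup>2)"
      by (auto simp: c_def indicator_def)
  qed
  also have "\<dots> = ?E (\<lambda>A. c A * (Z A - \<mu>)\<^sup>2) * (4 / \<mu>\<^sup>2)"
    by (rule integral_mult_left_zero)
  also have "\<dots> \<le> (1 / 2) ^ n * \<mu> * (4 / \<mu>\<^sup>2)"
    using second_moment \<mu>(2) by (intro mult_right_mono) auto
  also have "\<dots> = 4 / \<mu> * (1 / 2) ^ n"
    using \<mu>(2) by (simp add: field_simps power2_eq_square)
  finally show ?thesis
    unfolding prob_positive_tests_eq[OF P] Z_def .
qed

end

section \<open>The conditional first moment bound\<close>

text \<open>A set \<open>T\<close> is determined by its parts inside and outside \<open>S\<close>,
  of sizes \<open>l\<close> and \<open>k - l\<close>.\<close>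

lemma card_subsets_with_overlap:
  assumes "finite D" "S \<subseteq> D" "card S = k"
  shows "finite {T. T \<subseteq> D \<and> card T = k \<and> card (T \<inter> S) = l}"
    and "card {T. T \<subseteq> D \<and> card T = k \<and> card (T \<inter> S) = l} \<le>
      (k choose l) * ((card D - k) choose (k - l))"
proof -
  let ?T = "{T. T \<subseteq> D \<and> card T = k \<and> card (T \<inter> S) = l}"
  let ?A = "{X. X \<subseteq> S \<and> card X = l}" and ?B = "{X. X \<subseteq> D - S \<and> card X = k - l}"
  have fin: "finite S" "finite (D - S)"
    using assms finite_subset by auto
  show "finite ?T"
    using assms by (intro finite_subset[of ?T "Pow D"]) auto
  have "inj_on (\<lambda>T. (T \<inter> S, T - S)) ?T"
    by (rule inj_onI) blast
  moreover have "(\<lambda>T. (T \<inter> S, T - S)) ` ?T \<subseteq> ?A \<times> ?B"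
  proof (rule image_subsetI)
    fix T assume T: "T \<in> ?T"
    then have "finite T"
      using assms finite_subset by blast
    then have "card (T - S) = card T - card (T \<inter> S)"
      by (simp add: card_Diff_subset_Int)
    then show "(T \<inter> S, T - S) \<in> ?A \<times> ?B"
      using T by auto
  qed
  moreover have "finite (?A \<times> ?B)"
    using fin by simp
  ultimately have "card ?T \<le> card (?A \<times> ?B)"
    using card_inj_on_le by blast
  also have "\<dots> = (k choose l) * ((card D - k) choose (k - l))"
    using fin assms by (simp add: card_cartesian_product n_subsets card_Diff_subset)
  finally show "card ?T \<le> (k choose l) * ((card D - k) choose (k - l))" .
qed

context fixed_defectives
begin

text \<open>Rows that miss \<open>T\<close> but hit \<open>S\<close> are those that miss
  \<open>T\<close> without missing \<open>S \<union> T\<close>, a set of size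
  \<open>2 * k - l\<close>. The factor \<open>1 / 2\<close> is the probability of a positive test,
  so what remains is the conditional probability \<open>y\<close>.\<close>

lemma prob_row_hits_and_misses:
  assumes T: "T \<subseteq> {1..p}" "card T = k" and l: "card (T \<inter> S) = l"
  shows "measure_pmf.prob row_pmf (hits S \<inter> misses T) = 1 / 2 * (1 - 2 powr (real l / real k - 1))"
proof -
  have fin: "finite T"
    using T finite_subset by blast
  have "l \<le> k"
    using card_mono[of T "T \<inter> S"] fin T l by auto
  have "hits S \<inter> misses T = misses T - misses (S \<union> T)"
    by (auto simp: hits_def misses_def)
  then have "measure_pmf.prob row_pmf (hits S \<inter> misses T) =
      measure_pmf.prob row_pmf (misses T) - measure_pmf.prob row_pmf (misses (S \<union> T))"
    by (simp add: measure_pmf.finite_measure_Diff misses_def subset_eq)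
  also have "\<dots> = (1 - q) ^ k - (1 - q) ^ card (S \<union> T)"
    using T S_subset by (simp add: prob_row_misses)
  also have "card (S \<union> T) = k + (k - l)"
    using card_Un_Int[OF finite_S fin] card_S T l \<open>l \<le> k\<close> by (simp add: Int_commute)
  also have "(1 - q) ^ k - (1 - q) ^ (k + (k - l)) = 1 / 2 - 1 / 2 * (1 - q) ^ (k - l)"
    by (simp add: power_add half)
  also have "(1 - q) ^ (k - l) = 2 powr (real l / real k - 1)"
  proof -
    have "- (real (k - l) / real k) = real l / real k - 1"
      using \<open>l \<le> k\<close> k_pos by (simp add: of_nat_diff field_simps)
    then show ?thesis
      by (simp only: power_miss_eq_powr)
  qed
  finally show ?thesis
    by (simp add: algebra_simps)
qed

text \<open>The weight \<open>exp (- t)\<close> per missed positive test factors over rows, and each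
  positive row contributes its moment generating factor. Leaving \<open>Q\<close> arbitrary off
  \<open>P\<close> allows the negative rows to be held fixed.\<close>

lemma expectation_tilt:
  assumes P: "P \<subseteq> {1..n}" and Q: "\<And>i. i \<in> P \<Longrightarrow> Q i = hits S"
    and T: "T \<subseteq> {1..p}" "card T = k" "card (T \<inter> S) = l"
  defines "y \<equiv> 1 - 2 powr (real l / real k - 1)"
  shows "measure_pmf.expectation design_pmf (\<lambda>A.
      indicator {A. \<forall>i\<in>{1..n}. (\<lambda>j. A (i, j)) \<in> Q i} A *
      exp (- t * real (card {i \<in> P. (\<lambda>j. A (i, j)) \<in> misses T}))) =
    (1 - y + y * exp (- t)) ^ card P *
    measure_pmf.prob design_pmf {A. \<forall>i\<in>{1..n}. (\<lambda>j. A (i, j)) \<in> Q i}"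
proof -
  define g :: "nat \<Rightarrow> (nat \<Rightarrow> bool) \<Rightarrow> real" where
    "g i r = indicator (Q i) r * (if i \<in> P \<and> r \<in> misses T then exp (- t) else 1)" for i r
  have g: "measure_pmf.expectation row_pmf (g i) =
      measure_pmf.prob row_pmf (Q i) * (if i \<in> P then 1 - y + y * exp (- t) else 1)" for i
  proof (cases "i \<in> P")
    case True
    \<comment> \<open>On a positive row the weight is \<open>1\<close>, lowered by
      \<open>1 - exp (- t)\<close> exactly when the row misses \<open>T\<close>.\<close>
    then have "g i = (\<lambda>r. indicator (hits S) r - (1 - exp (- t)) * indicator (hits S \<inter> misses T) r)"
      by (auto simp: g_def Q indicator_def fun_eq_iff)
    then have "measure_pmf.expectation row_pmf (g i) =
        measure_pmf.prob row_pmf (hits S)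
          - (1 - exp (- t)) * measure_pmf.prob row_pmf (hits S \<inter> misses T)"
      by (simp add: integrable_measure_pmf_finite[OF finite_row_pmf])
    also have "\<dots> = 1 / 2 * (1 - y + y * exp (- t))"
      unfolding prob_row_hits_and_misses[OF T] prob_row_hits y_def by (simp add: field_simps)
    finally show ?thesis
      using True by (simp add: Q prob_row_hits)
  next
    case False
    then have "g i = indicator (Q i)"
      by (simp add: g_def fun_eq_iff)
    then show ?thesis
      using False by simp
  qed
  have "indicator {A. \<forall>i\<in>{1..n}. (\<lambda>j. A (i, j)) \<in> Q i} A *
      exp (- t * real (card {i \<in> P. (\<lambda>j. A (i, j)) \<in> misses T})) =
      (\<Prod>i\<in>{1..n}. g i (\<lambda>j. A (i, j)))" for A
  proof -
    have "(\<Prod>i\<in>{1..n}. indicator (Q i) (\<lambda>j. A (i, j))) =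
        (indicator {A. \<forall>i\<in>{1..n}. (\<lambda>j. A (i, j)) \<in> Q i} A :: real)"
      by (auto simp: indicator_def)
    moreover have "(\<Prod>i\<in>{1..n}. if i \<in> P \<and> (\<lambda>j. A (i, j)) \<in> misses T then exp (- t) else 1) =
        exp (- t * real (card {i \<in> P. (\<lambda>j. A (i, j)) \<in> misses T}))"
    proof -
      have "{1..n} \<inter> {i. i \<in> P \<and> (\<lambda>j. A (i, j)) \<in> misses T} =
          {i \<in> P. (\<lambda>j. A (i, j)) \<in> misses T}"
        using P by auto
      then show ?thesis
        by (simp add: prod.If_cases mult.commute flip: exp_of_nat_mult)
    qed
    ultimately show ?thesis
      unfolding g_def prod.distrib by simp
  qed
  then have "measure_pmf.expectation design_pmf (\<lambda>A.
      indicator {A. \<forall>i\<in>{1..n}. (\<lambda>j. A (i, j)) \<in> Q i} A *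
      exp (- t * real (card {i \<in> P. (\<lambda>j. A (i, j)) \<in> misses T}))) =
    measure_pmf.expectation design_pmf (\<lambda>A. \<Prod>i\<in>{1..n}. g i (\<lambda>j. A (i, j)))"
    by simp
  also have "\<dots> = (\<Prod>i\<in>{1..n}. measure_pmf.expectation row_pmf (g i))"
    unfolding design_pmf_def row_pmf_def by (rule expectation_prod_rows) (auto simp: g_def)
  also have "\<dots> = (\<Prod>i\<in>{1..n}. measure_pmf.prob row_pmf (Q i)) *
      (\<Prod>i\<in>{1..n}. if i \<in> P then 1 - y + y * exp (- t) else 1)"
    unfolding g prod.distrib ..
  also have "(\<Prod>i\<in>{1..n}. if i \<in> P then 1 - y + y * exp (- t) else 1) =
      (1 - y + y * exp (- t)) ^ card P"
    using P by (simp add: prod.If_cases Int_absorb1)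
  finally show ?thesis
    by (simp only: prob_design_rows mult.commute)
qed

text \<open>This is Markov's inequality for \<open>exp (- t * count)\<close>, the Chernoff bound for
  a lower tail, restricted to the event fixed by \<open>Q\<close>.\<close>

lemma prob_few_misses:
  assumes P: "P \<subseteq> {1..n}" and Q: "\<And>i. i \<in> P \<Longrightarrow> Q i = hits S"
    and T: "T \<subseteq> {1..p}" "card T = k" "card (T \<inter> S) = l" and t: "0 \<le> t"
  defines "y \<equiv> 1 - 2 powr (real l / real k - 1)"
  shows "measure_pmf.prob design_pmf {A. (\<forall>i\<in>{1..n}. (\<lambda>j. A (i, j)) \<in> Q i) \<and>
      real (card {i \<in> P. (\<lambda>j. A (i, j)) \<in> misses T}) < h} \<le>
    exp (t * h) * (1 - y + y * exp (- t)) ^ card P *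
    measure_pmf.prob design_pmf {A. \<forall>i\<in>{1..n}. (\<lambda>j. A (i, j)) \<in> Q i}"
proof -
  let ?C = "{A. \<forall>i\<in>{1..n}. (\<lambda>j. A (i, j)) \<in> Q i}"
  let ?c = "\<lambda>A. real (card {i \<in> P. (\<lambda>j. A (i, j)) \<in> misses T})"
  let ?E = "measure_pmf.expectation design_pmf"
  have "measure_pmf.prob design_pmf {A. (\<forall>i\<in>{1..n}. (\<lambda>j. A (i, j)) \<in> Q i) \<and> ?c A < h} =
      ?E (indicator {A. (\<forall>i\<in>{1..n}. (\<lambda>j. A (i, j)) \<in> Q i) \<and> ?c A < h})"
    by simp
  also have "\<dots> \<le> ?E (\<lambda>A. exp (t * h) * (indicator ?C A * exp (- t * ?c A)))"
  proof (intro integral_mono integrable_measure_pmf_finite[OF finite_design_pmf])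
    fix A
    have "1 \<le> exp (t * h) * exp (- t * ?c A)" if "?c A < h"
    proof -
      have "t * ?c A \<le> t * h"
        using that t by (intro mult_left_mono) auto
      then show ?thesis
        by (simp add: exp_add[symmetric])
    qed
    then show "indicator {A. (\<forall>i\<in>{1..n}. (\<lambda>j. A (i, j)) \<in> Q i) \<and> ?c A < h} A \<le>
        exp (t * h) * (indicator ?C A * exp (- t * ?c A))"
      by (auto simp: indicator_def)
  qed
  also have "\<dots> = exp (t * h) * ?E (\<lambda>A. indicator ?C A * exp (- t * ?c A))"
    by (rule integral_mult_right_zero)
  also have "\<dots> = exp (t * h) * ((1 - y + y * exp (- t)) ^ card P * measure_pmf.prob design_pmf ?C)"
    unfolding y_def by (subst expectation_tilt[OF P Q T]) auto
  finally show ?thesis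
    by (simp add: mult.assoc)
qed

section \<open>Conditioning on the pattern, and the union bound inside a cell\<close>

text \<open>The information conditioned on: which tests are positive, and the rows of the negative ones.\<close>

definition pattern :: "(nat \<times> nat \<Rightarrow> bool) \<Rightarrow> nat set \<times> (nat \<Rightarrow> nat \<Rightarrow> bool)" where
  "pattern A = (positive_tests n (S, A),
    \<lambda>i. if i \<in> {1..n} - positive_tests n (S, A) then (\<lambda>j. A (i, j)) else (\<lambda>_. False))"

text \<open>A cell of the conditioning is a product event with one condition per row, the form that
  \<open>prob_few_misses\<close> requires.\<close>

lemma pattern_eq_iff:
  "pattern A = pattern A0 \<longleftrightarrow> (\<forall>i\<in>{1..n}. (\<lambda>j. A (i, j)) \<in>
    (if i \<in> positive_tests n (S, A0) then hits S else {\<lambda>j. A0 (i, j)}))"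
proof
  assume eq: "pattern A = pattern A0"
  have pos: "positive_tests n (S, A) = positive_tests n (S, A0)"
    using arg_cong[OF eq, of fst] by (simp add: pattern_def)
  have rows: "(\<lambda>j. A (i, j)) = (\<lambda>j. A0 (i, j))" if "i \<in> {1..n} - positive_tests n (S, A0)" for i
    using fun_cong[OF arg_cong[OF eq, of snd], of i] that by (simp only: pattern_def snd_conv pos if_True)
  show "\<forall>i\<in>{1..n}. (\<lambda>j. A (i, j)) \<in>
      (if i \<in> positive_tests n (S, A0) then hits S else {\<lambda>j. A0 (i, j)})"
  proof
    fix i assume i: "i \<in> {1..n}"
    show "(\<lambda>j. A (i, j)) \<in> (if i \<in> positive_tests n (S, A0) then hits S else {\<lambda>j. A0 (i, j)})"
    proof (cases "i \<in> positive_tests n (S, A0)")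
      case True
      then have "i \<in> positive_tests n (S, A)"
        by (simp only: pos)
      with True show ?thesis
        by (simp add: positive_tests_eq)
    next
      case False
      with i rows[of i] show ?thesis
        by simp
    qed
  qed
next
  assume R: "\<forall>i\<in>{1..n}. (\<lambda>j. A (i, j)) \<in>
    (if i \<in> positive_tests n (S, A0) then hits S else {\<lambda>j. A0 (i, j)})"
  then have "(\<lambda>j. A (i, j)) \<in> hits S \<longleftrightarrow> (\<lambda>j. A0 (i, j)) \<in> hits S" if "i \<in> {1..n}" for i
    using bspec[OF R that] that by (auto simp: positive_tests_eq split: if_splits)
  then have pos: "positive_tests n (S, A) = positive_tests n (S, A0)"
    by (auto simp: positive_tests_eq)
  have "(\<lambda>j. A (i, j)) = (\<lambda>j. A0 (i, j))" if "i \<in> {1..n} - positive_tests n (S, A0)" for i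
    using bspec[OF R, of i] that by simp
  then show "pattern A = pattern A0"
    by (simp add: pattern_def pos fun_eq_iff)
qed

text \<open>Whether an item is potentially defective depends on the negative rows only. So the set
  of candidates is constant on a cell, and a union bound over it makes sense there.\<close>

lemma pattern_determines:
  assumes "pattern A = pattern A0"
  shows "positive_tests n (S, A) = positive_tests n (S, A0)"
    and "potential_defectives p n (S, A) = potential_defectives p n (S, A0)"
proof -
  show pos: "positive_tests n (S, A) = positive_tests n (S, A0)"
    using assms by (simp add: pattern_def)
  have "A (i, j) = A0 (i, j)" if "i \<in> {1..n} - positive_tests n (S, A0)" for i j
    using assms[unfolded pattern_eq_iff, rule_format, of i] that by (simp add: fun_eq_iff)
  then show "potential_defectives p n (S, A) = potential_defectives p n (S, A0)"
    by (auto simp: potential_defectives_def pos)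
qed

lemma S_subset_potential_defectives: "S \<subseteq> potential_defectives p n (S, A)"
  using S_subset by (auto simp: potential_defectives_def positive_tests_def)

lemma finite_potential_defectives: "finite (potential_defectives p n (S, A))"
  by (simp add: potential_defectives_def)

text \<open>Candidates are represented by their supports \<open>T\<close>; \<open>phi_ge\<close>
  passes back to binary vectors.\<close>

definition under_explained :: "nat \<Rightarrow> real \<Rightarrow> (nat \<times> nat \<Rightarrow> bool) set" where
  "under_explained l h = {A. \<exists>T \<subseteq> potential_defectives p n (S, A). card T = k \<and> card (T \<inter> S) = l \<and>
    real (card {i \<in> positive_tests n (S, A). (\<lambda>j. A (i, j)) \<in> misses T}) < h}"

lemma prob_under_explained:
  fixes A0 :: "nat \<times> nat \<Rightarrow> bool"
  defines "m \<equiv> n_pos n (S, A0)" and "d \<equiv> p_rem p n (S, A0)"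
  assumes l: "l < k" and F: "is_F d k m (real l / real k) x"
    and c: "0 < c" "c * real m \<le> ln (real ((k choose l) * ((d - k) choose (k - l))))" and C: "0 \<le> C"
  shows "measure_pmf.prob design_pmf
      {A. pattern A = pattern A0 \<and> A \<in> under_explained l (real m * x - C * ln (real k))} \<le>
    real k powr - (c * C) * measure_pmf.prob design_pmf {A. pattern A = pattern A0}"
\<comment> \<open>At \<open>x = 0\<close> the optimal tilt would be infinite, but then the threshold
  is at most \<open>0\<close> and no count lies strictly below it.\<close>
proof (cases "x = 0")
  case True
  have "0 \<le> C * ln (real k)"
    using C k_pos by simp
  then have "\<not> real a < real m * x - C * ln (real k)" for a
    using True by simp
  then have "{A. pattern A = pattern A0 \<and> A \<in> under_explained l (real m * x - C * ln (real k))} = {}"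
    unfolding under_explained_def by blast
  then show ?thesis
    by (simp only:) simp
next
  case False
  define N where "N = (k choose l) * ((d - k) choose (k - l))"
  define y where "y = 1 - 2 powr (real l / real k - 1)"
  define t where "t = ln (y * (1 - x) / (x * (1 - y)))"
  define h where "h = real m * x - C * ln (real k)"
  let ?P = "positive_tests n (S, A0)" and ?D = "potential_defectives p n (S, A0)"
  let ?T = "{T. T \<subseteq> ?D \<and> card T = k \<and> card (T \<inter> S) = l}"
  let ?pat = "{A. pattern A = pattern A0}"
  have x: "0 \<le> x" "x \<le> y" and alpha: "alpha_div x y = ln (real N) / real m"
    and pos: "0 < m" "0 < N"
    using F unfolding is_F_iff[OF l] by (simp_all add: y_def N_def)
  have "x > 0"
    using x False by simp
  have y: "0 < y" "y < 1"
    using l by (simp_all add: y_def powr_less_one)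
  have "c \<le> ln (real N) / real m"
    using c pos by (simp add: N_def field_simps)
  also have "\<dots> \<le> t"
    unfolding t_def alpha[symmetric] using \<open>0 < x\<close> x y by (intro alpha_div_le_tilt) auto
  finally have t: "c \<le> t" .
  have "{A. pattern A = pattern A0 \<and> A \<in> under_explained l h} \<subseteq>
      (\<Union>T\<in>?T. {A. pattern A = pattern A0 \<and>
        real (card {i \<in> ?P. (\<lambda>j. A (i, j)) \<in> misses T}) < h})"
  proof
    fix A assume A: "A \<in> {A. pattern A = pattern A0 \<and> A \<in> under_explained l h}"
    then obtain T where T: "T \<subseteq> potential_defectives p n (S, A)" "card T = k" "card (T \<inter> S) = l"
      "real (card {i \<in> positive_tests n (S, A). (\<lambda>j. A (i, j)) \<in> misses T}) < h"
      unfolding under_explained_def by blast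
    have pattern: "pattern A = pattern A0"
      using A by simp
    show "A \<in> (\<Union>T\<in>?T. {A. pattern A = pattern A0 \<and>
        real (card {i \<in> ?P. (\<lambda>j. A (i, j)) \<in> misses T}) < h})"
      using T unfolding pattern_determines[OF pattern] by (intro UN_I[of T]) (simp_all add: pattern)
  qed
  then have "measure_pmf.prob design_pmf {A. pattern A = pattern A0 \<and> A \<in> under_explained l h} \<le>
      measure_pmf.prob design_pmf (\<Union>T\<in>?T. {A. pattern A = pattern A0 \<and>
        real (card {i \<in> ?P. (\<lambda>j. A (i, j)) \<in> misses T}) < h})"
    by (rule measure_pmf.finite_measure_mono) simp
  also have "\<dots> \<le> (\<Sum>T\<in>?T. measure_pmf.prob design_pmf {A. pattern A = pattern A0 \<and>
        real (card {i \<in> ?P. (\<lambda>j. A (i, j)) \<in> misses T}) < h})"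
    using card_subsets_with_overlap(1)[OF finite_potential_defectives S_subset_potential_defectives card_S]
    by (rule measure_pmf.finite_measure_subadditive_finite) simp
  also have "\<dots> \<le> (\<Sum>T\<in>?T. exp (t * h) * (1 - y + y * exp (- t)) ^ m *
      measure_pmf.prob design_pmf ?pat)"
  proof (rule sum_mono)
    fix T assume "T \<in> ?T"
    then have T: "T \<subseteq> {1..p}" "card T = k" "card (T \<inter> S) = l"
      by (auto simp: potential_defectives_def)
    show "measure_pmf.prob design_pmf {A. pattern A = pattern A0 \<and>
        real (card {i \<in> ?P. (\<lambda>j. A (i, j)) \<in> misses T}) < h} \<le>
        exp (t * h) * (1 - y + y * exp (- t)) ^ m * measure_pmf.prob design_pmf ?pat"
      unfolding pattern_eq_iff y_def m_def n_pos_def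
      using T t c by (intro prob_few_misses) (auto simp: positive_tests_def)
  qed
  also have "\<dots> = real (card ?T) * (exp (t * h) * (1 - y + y * exp (- t)) ^ m *
      measure_pmf.prob design_pmf ?pat)"
    by simp
  also have "\<dots> \<le> real N * (exp (t * h) * (1 - y + y * exp (- t)) ^ m *
      measure_pmf.prob design_pmf ?pat)"
    using card_subsets_with_overlap(2)[OF finite_potential_defectives S_subset_potential_defectives card_S]
      y by (intro mult_right_mono) (auto simp: N_def d_def p_rem_def simp flip: of_nat_mult)
  also have "\<dots> = (real N * exp (- real m * alpha_div x y)) * exp (- (t * C * ln (real k))) *
      measure_pmf.prob design_pmf ?pat"
  proof -
    have "exp (t * h) = exp (t * (real m * x)) * exp (- (t * C * ln (real k)))"
      unfolding h_def by (simp add: algebra_simps flip: exp_add)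
    then show ?thesis
      using chernoff_tilt[of x y m] \<open>0 < x\<close> x y by (simp add: t_def mult_ac)
  qed
  \<comment> \<open>The defining equation of \<open>F\<close> makes the number of candidates cancel
    the Chernoff exponent exactly; only the gain from lowering the threshold by
    \<open>C * ln k\<close> is left.\<close>
  also have "real N * exp (- real m * alpha_div x y) = 1"
    unfolding alpha using pos by (simp add: exp_minus)
  also have "1 * exp (- (t * C * ln (real k))) \<le> real k powr - (c * C)"
    using k_pos t C by (auto simp: powr_def intro!: mult_right_mono)
  finally show ?thesis
    unfolding h_def by (simp add: mult_right_mono)
qed

text \<open>Since \<open>n_pos\<close> and \<open>p_rem\<close> are constant on a cell,
  \<open>G\<close> holds on all of it or nowhere. The union over \<open>L\<close> costs the factor
  \<open>k\<close>.\<close>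

lemma prob_some_under_explained:
  assumes c: "0 < c" and C: "0 \<le> C" and L: "L \<subseteq> {..<k}"
    and G: "\<And>m d l. G m d \<Longrightarrow> l \<in> L \<Longrightarrow> (\<exists>!x. is_F d k m (real l / real k) x) \<and>
      c * real m \<le> ln (real ((k choose l) * ((d - k) choose (k - l))))"
  shows "measure_pmf.prob design_pmf {A. G (n_pos n (S, A)) (p_rem p n (S, A)) \<and>
      (\<exists>l\<in>L. A \<in> under_explained l (real (n_pos n (S, A)) *
        F (p_rem p n (S, A)) k (n_pos n (S, A)) (real l / real k) - C * ln (real k)))} \<le>
    real k * real k powr - (c * C)"
    (is "measure_pmf.prob _ ?bad \<le> _")
proof (rule prob_le_by_cells[OF finite_design_pmf, where \<Phi> = pattern])
  fix z
  show "measure_pmf.prob design_pmf {A \<in> ?bad. pattern A = z} \<le>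
      real k * real k powr - (c * C) * measure_pmf.prob design_pmf {A. pattern A = z}"
  proof (cases "\<exists>A0. pattern A0 = z \<and> G (n_pos n (S, A0)) (p_rem p n (S, A0))")
    case True
    then obtain A0 where z: "z = pattern A0" and A0: "G (n_pos n (S, A0)) (p_rem p n (S, A0))"
      by auto
    define m d where "m = n_pos n (S, A0)" and "d = p_rem p n (S, A0)"
    let ?ev = "\<lambda>l. {A. pattern A = pattern A0 \<and>
      A \<in> under_explained l (real m * F d k m (real l / real k) - C * ln (real k))}"
    have fin: "finite L" "card L \<le> k"
      using L finite_subset card_mono[of "{..<k}" L] by auto
    have "{A \<in> ?bad. pattern A = z} \<subseteq> (\<Union>l\<in>L. ?ev l)"
    proof
      fix A assume A: "A \<in> {A \<in> ?bad. pattern A = z}"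
      then have pattern: "pattern A = pattern A0"
        by (simp add: z)
      then have "n_pos n (S, A) = m" "p_rem p n (S, A) = d"
        using pattern_determines[OF pattern] by (simp_all add: n_pos_def p_rem_def m_def d_def)
      then show "A \<in> (\<Union>l\<in>L. ?ev l)"
        using A pattern by auto
    qed
    then have "measure_pmf.prob design_pmf {A \<in> ?bad. pattern A = z} \<le>
        measure_pmf.prob design_pmf (\<Union>l\<in>L. ?ev l)"
      by (rule measure_pmf.finite_measure_mono) simp
    also have "\<dots> \<le> (\<Sum>l\<in>L. measure_pmf.prob design_pmf (?ev l))"
      using fin(1) by (rule measure_pmf.finite_measure_subadditive_finite) simp
    also have "\<dots> \<le> (\<Sum>l\<in>L. real k powr - (c * C) * measure_pmf.prob design_pmf {A. pattern A = z})"
    proof (rule sum_mono)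
      fix l assume l: "l \<in> L"
      \<comment> \<open>\<open>F\<close> is a definite description, so the uniqueness contained in
        \<open>G\<close> is what makes it solve its equation.\<close>
      have "is_F d k m (real l / real k) (F d k m (real l / real k))"
        unfolding F_def m_def d_def by (rule theI'[OF conjunct1[OF G[OF A0 l]]])
      then show "measure_pmf.prob design_pmf (?ev l) \<le>
          real k powr - (c * C) * measure_pmf.prob design_pmf {A. pattern A = z}"
        unfolding z m_def d_def using l L c C G[OF A0 l] by (intro prob_under_explained) auto
    qed
    also have "\<dots> = real (card L) * (real k powr - (c * C) * measure_pmf.prob design_pmf {A. pattern A = z})"
      by simp
    also have "\<dots> \<le> real k * (real k powr - (c * C) * measure_pmf.prob design_pmf {A. pattern A = z})"
      using fin by (intro mult_right_mono) auto
    finally show ?thesis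
      by (simp add: mult.assoc)
  next
    case False
    then have "{A \<in> ?bad. pattern A = z} = {}"
      by auto
    then show ?thesis
      by (simp only:) simp
  qed
qed simp

lemma phi_ge:
  assumes "A \<notin> under_explained l r"
  shows "ereal r \<le> phi p k n (S, A) l"
proof -
  let ?D = "potential_defectives p n (S, A)"
  have "r \<le> real (H p n (S, A) \<theta>)"
    if \<theta>: "\<theta> \<in> binary_vectors ?D" "norm0 ?D \<theta> = k" "dot ?D \<theta> (theta_star (S, A)) = l" for \<theta>
  proof -
    let ?T = "{j \<in> ?D. \<theta> j \<noteq> 0}"
    \<comment> \<open>Because the entries of \<open>\<theta>\<close> are \<open>0\<close> or
      \<open>1\<close>, the inner product counts the overlap of its support with
      \<open>S\<close>.\<close>
    have "dot ?D \<theta> (theta_star (S, A)) = (\<Sum>j\<in>?D. if j \<in> ?T \<inter> S then 1 else 0)"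
      unfolding dot_def
    proof (rule sum.cong[OF refl])
      fix j assume "j \<in> ?D"
      moreover from this have "\<theta> j \<in> {0, 1}"
        using \<theta>(1) by (auto simp: binary_vectors_def dest: PiE_mem)
      ultimately show "\<theta> j * theta_star (S, A) j = (if j \<in> ?T \<inter> S then 1 else 0)"
        by (auto simp: theta_star_def)
    qed
    also have "\<dots> = card (?T \<inter> S)"
      using finite_potential_defectives by (subst sum.If_cases) (auto intro: arg_cong[where f = card])
    finally have "card (?T \<inter> S) = l"
      using \<theta> by simp
    moreover have "card ?T = k"
      using \<theta> by (simp add: norm0_def)
    moreover have "?T \<subseteq> ?D"
      by auto
    ultimately have "r \<le> real (card {i \<in> positive_tests n (S, A). (\<lambda>j. A (i, j)) \<in> misses ?T})"
      using assms unfolding under_explained_def by (simp add: not_less)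
    also have "{i \<in> positive_tests n (S, A). (\<lambda>j. A (i, j)) \<in> misses ?T} =
        {i \<in> positive_tests n (S, A). dot ?D (X_row (S, A) i) \<theta> = 0}"
      using finite_potential_defectives by (auto simp: dot_def misses_def X_row_def split: if_splits)
    finally show ?thesis
      by (simp add: H_def)
  qed
  then show ?thesis
    unfolding phi_def Let_def by (auto intro!: INF_greatest)
qed

end

section \<open>Counting candidates\<close>

text \<open>One term of the expansion of \<open>(1 + x) ^ Z\<close> is at most
  \<open>exp (x * Z)\<close>; the choice \<open>x = s / Z\<close> makes that bound
  \<open>exp s\<close>.\<close>

lemma binomial_le_exp_pow:
  assumes "0 < s"
  shows "real (Z choose s) \<le> (exp 1 * real Z / real s) ^ s"
proof (cases "Z = 0")
  case False
  define x where "x = real s / real Z"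
  have x: "0 < x"
    using assms False by (simp add: x_def)
  have "real (Z choose s) * x ^ s \<le> (x + 1) ^ Z"
  proof (cases "s \<le> Z")
    case True
    then have "real (Z choose s) * x ^ s * 1 ^ (Z - s) \<le> (\<Sum>i\<le>Z. real (Z choose i) * x ^ i * 1 ^ (Z - i))"
      using x by (intro member_le_sum) auto
    then show ?thesis
      by (simp add: binomial_ring)
  next
    case False
    then show ?thesis
      using x by (simp add: binomial_eq_0)
  qed
  also have "\<dots> \<le> exp x ^ Z"
    using x by (intro power_mono) (auto simp: add.commute)
  also have "\<dots> = exp 1 ^ s"
    using False by (simp add: x_def flip: exp_of_nat_mult)
  finally have "real (Z choose s) \<le> exp 1 ^ s / x ^ s"
    using x by (simp add: field_simps)
  also have "\<dots> = (exp 1 * real Z / real s) ^ s"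
    by (simp add: x_def power_divide power_mult_distrib)
  finally show ?thesis .
qed (use assms in \<open>simp add: binomial_eq_0\<close>)

lemma ln_binomial_upper:
  assumes "0 < s" "s \<le> Z"
  shows "ln (real (Z choose s)) \<le> real s * (1 + ln (real Z / real s))"
proof -
  have "ln (real (Z choose s)) \<le> ln ((exp 1 * real Z / real s) ^ s)"
    using assms binomial_le_exp_pow[of s Z] by (subst ln_le_cancel_iff) auto
  also have "\<dots> = real s * (1 + ln (real Z / real s))"
    using assms by (simp add: ln_realpow ln_mult ln_div)
  finally show ?thesis .
qed

lemma ln_binomial_lower:
  assumes "0 < s" "s \<le> Z"
  shows "real s * ln (real Z / real s) \<le> ln (real (Z choose s))"
proof -
  have "real s * ln (real Z / real s) = ln ((real Z / real s) ^ s)"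
    using assms by (simp add: ln_realpow)
  also have "\<dots> \<le> ln (real (Z choose s))"
    using assms binomial_ge_n_over_k_pow_k[of s Z, where 'a = real]
    by (subst ln_le_cancel_iff) auto
  finally show ?thesis .
qed

text \<open>The upper bound is proportional to \<open>k - l\<close>, as is the bound that
  \<open>is_F_ex1\<close> asks for. Since \<open>k - l\<close> is at least
  \<open>\<delta> * k\<close>, the factor \<open>k choose l\<close>, at most \<open>2 ^ k\<close>,
  costs \<open>1 / \<delta>\<close> per unit of \<open>k - l\<close>; the other
  \<open>1 / \<delta>\<close> comes from \<open>ln (1 / \<delta>)\<close>.\<close>

lemma ln_count_bounds:
  fixes \<delta> :: real
  assumes k: "0 < k" and Z: "k \<le> Z" and \<delta>: "0 < \<delta>" "\<delta> \<le> 1" and l: "real l \<le> (1 - \<delta>) * real k"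
  defines "N \<equiv> (k choose l) * (Z choose (k - l))"
  shows "0 < N"
    and "ln (real N) \<le> real (k - l) * (2 / \<delta> + 1 + ln (real Z / real k))"
    and "\<delta> * real k * ln (real Z / real k) \<le> ln (real N)"
proof -
  define s where "s = k - l"
  have "0 < \<delta> * real k"
    using k \<delta> by simp
  then have "real l < real k"
    using l unfolding left_diff_distrib by linarith
  then have s: "0 < s" "s \<le> k" "s \<le> Z" "real s = real k - real l" "l \<le> k"
    using Z by (auto simp: s_def)
  have ds: "\<delta> * real k \<le> real s"
    using l s by (simp add: algebra_simps)
  have pos: "0 < k choose l" "0 < Z choose s"
    using s by simp_all
  then show "0 < N"
    by (simp add: N_def s_def)
  have N: "ln (real N) = ln (real (k choose l)) + ln (real (Z choose s))"
    using pos by (simp add: N_def s_def ln_mult)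
  have r: "0 \<le> ln (real Z / real k)"
    using k Z by simp
  have "\<delta> * real k * ln (real Z / real k) \<le> real s * ln (real Z / real k)"
    using ds r by (rule mult_right_mono)
  also have "\<dots> \<le> real s * ln (real Z / real s)"
    using s k Z by (intro mult_left_mono) (auto intro!: divide_left_mono)
  also have "\<dots> \<le> ln (real (Z choose s))"
    using s by (intro ln_binomial_lower)
  also have "\<dots> \<le> ln (real N)"
    using pos by (simp add: N Suc_le_eq)
  finally show "\<delta> * real k * ln (real Z / real k) \<le> ln (real N)" .
  have "real k \<le> real s / \<delta>"
    using ds \<delta> by (simp add: field_simps)
  have "real (k choose l) \<le> real (2 ^ k)"
    unfolding of_nat_le_iff by (rule binomial_le_pow2)
  then have "ln (real (k choose l)) \<le> ln (2 ^ k)"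
    using pos by (intro ln_mono) simp_all
  also have "\<dots> \<le> real k"
    using ln2_le_25_over_36 by (simp add: ln_realpow mult_left_le)
  finally have 1: "ln (real (k choose l)) \<le> real s * (1 / \<delta>)"
    using \<open>real k \<le> real s / \<delta>\<close> by simp
  have "ln (real Z / real s) \<le> ln ((1 / \<delta>) * (real Z / real k))"
  proof (rule ln_mono)
    have "real Z / real s \<le> real Z / (\<delta> * real k)"
      using ds s k \<delta> by (intro divide_left_mono) auto
    then show "real Z / real s \<le> 1 / \<delta> * (real Z / real k)"
      by simp
  qed (use s Z in simp)
  also have "\<dots> \<le> 1 / \<delta> + ln (real Z / real k)"
  proof -
    have "ln (1 / \<delta> * (real Z / real k)) = ln (1 / \<delta>) + ln (real Z / real k)"
      using k Z \<delta> by (intro ln_mult_pos) auto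
    moreover have "ln (1 / \<delta>) < 1 / \<delta>"
      using \<delta> by (intro ln_less_self) simp
    ultimately show ?thesis
      by linarith
  qed
  finally have "real s * (1 + ln (real Z / real s)) \<le> real s * (1 + (1 / \<delta> + ln (real Z / real k)))"
    by (intro mult_left_mono) auto
  then have 2: "ln (real (Z choose s)) \<le> real s * (1 + (1 / \<delta> + ln (real Z / real k)))"
    using ln_binomial_upper[of s Z] s by linarith
  show "ln (real N) \<le> real (k - l) * (2 / \<delta> + 1 + ln (real Z / real k))"
  proof -
    have "2 / \<delta> = 1 / \<delta> + 1 / \<delta>"
      by simp
    then show ?thesis
      using 1 2 unfolding N s_def[symmetric] by (simp only: distrib_left)
  qed
qed

text \<open>Here \<open>\<mu>\<close> is the conditional mean of \<open>p' - k\<close>, and \<open>(p / k) powr a\<close> is, up to a constant factor,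
  a lower bound for \<open>\<mu> / k\<close>; the positivity of \<open>b\<close> is what makes \<open>F\<close> exist.\<close>

lemma counts_in_range:
  fixes R \<eta> \<delta> L :: real and p k n m Z :: nat
  defines "a \<equiv> 1 - (1 / 2 + \<eta>) / R" and "b \<equiv> (1 - 2 * \<eta>) / R - 1"
    and "\<mu> \<equiv> real (p - k) * 2 powr - (real (n - m) / real k)"
  assumes R: "1 / 2 < R" "R < 1" and \<eta>: "0 < \<eta>" "1 / 2 + \<eta> < R"
    and \<delta>: "0 < \<delta>" "\<delta> \<le> 1"
    and k: "0 < k" "2 * k \<le> p" and L: "L = ln (real p / real k)" "1 \<le> L"
    and L_a: "10 \<le> a * L" and L_b: "2 / \<delta> + 4 \<le> b * L"
    and n: "real k * L / R - 1 \<le> real n * ln 2" "real n * ln 2 \<le> real k * (L + 1) / R + 1"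
    and m: "\<bar>real m - real n / 2\<bar> \<le> \<eta> * real n"
  shows "real k \<le> \<mu>"
    and "\<bar>real Z - \<mu>\<bar> \<le> \<mu> / 2 \<Longrightarrow> real l \<le> (1 - \<delta>) * real k \<Longrightarrow>
      (\<exists>!x. is_F (k + Z) k m (real l / real k) x) \<and>
      \<delta> * a / 20 * real m \<le> ln (real ((k choose l) * ((k + Z - k) choose (k - l))))"
proof -
  \<comment> \<open>Exponents are measured in units of \<open>k\<close>: \<open>exp (- w)\<close> is
    the chance that a nondefective item avoids every negative test, and \<open>u\<close> is close to
    \<open>A\<close>.\<close>
  define u where "u = real n * ln 2 / real k"
  define w where "w = real (n - m) * ln 2 / real k"
  define A where "A = L / R"
  have aL: "a * L = L - (1 / 2 + \<eta>) * A" and bL: "b * L = (1 - 2 * \<eta>) * A - L"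
    by (simp_all add: a_def b_def A_def left_diff_distrib)
  have ln2: "1 / 2 \<le> ln (2::real)"
    using ln2_ge_two_thirds by simp
  have "A - 1 \<le> A - 1 / real k"
    using k by simp
  also have "\<dots> \<le> u"
    using divide_right_mono[OF n(1), of "real k"] k by (simp add: u_def A_def diff_divide_distrib)
  finally have u_lower: "A - 1 \<le> u" .
  have "1 / R \<le> 2"
    using R by (simp add: field_simps)
  have "u \<le> (L + 1) / R + 1 / real k"
    using divide_right_mono[OF n(2), of "real k"] k by (simp add: u_def add_divide_distrib)
  also have "\<dots> = A + 1 / R + 1 / real k"
    by (simp add: A_def add_divide_distrib)
  also have "\<dots> \<le> A + 2 + 1"
    using k by (intro add_mono \<open>1 / R \<le> 2\<close>) auto
  finally have u_upper: "u \<le> A + 3"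
    by simp
  have "\<eta> < 1 / 2"
    using \<eta> R by simp
  have m_upper: "real m \<le> (1 / 2 + \<eta>) * real n" and m_lower: "(1 / 2 - \<eta>) * real n \<le> real m"
    using m by (simp_all add: algebra_simps abs_le_iff)
  have "(1 / 2 + \<eta>) * real n \<le> real n"
    using \<open>\<eta> < 1 / 2\<close> by (intro mult_left_le_one_le) (use \<eta> in auto)
  with m_upper have "m \<le> n"
    by simp
  have u0: "0 \<le> u"
    by (simp add: u_def)
  have scale: "c * real n \<le> x \<Longrightarrow> c * u \<le> x * ln 2 / real k"
    "x \<le> c * real n \<Longrightarrow> x * ln 2 / real k \<le> c * u" for c x :: real
    using k by (simp_all add: u_def field_simps mult_right_mono)
  have w_upper: "w \<le> (1 / 2 + \<eta>) * u" and w_lower: "(1 / 2 - \<eta>) * u \<le> w"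
    unfolding w_def using m_upper m_lower \<open>m \<le> n\<close>
    by (intro scale; simp add: of_nat_diff algebra_simps)+
  have "(1 / 2 + \<eta>) * u \<le> (1 / 2 + \<eta>) * (A + 3)"
    using u_upper \<eta> by (intro mult_left_mono) auto
  also have "\<dots> \<le> (1 / 2 + \<eta>) * A + 3"
  proof -
    have "(1 / 2 + \<eta>) * 3 \<le> 3"
      using \<open>\<eta> < 1 / 2\<close> by simp
    then show ?thesis
      unfolding distrib_left by (rule add_left_mono)
  qed
  finally have w1: "L - w \<ge> a * L - 3"
    using w_upper unfolding aL by linarith
  have half_lower: "(1 / 2 - \<eta>) * A - 1 \<le> (1 / 2 - \<eta>) * u"
  proof -
    have "(1 / 2 - \<eta>) * (A - 1) \<le> (1 / 2 - \<eta>) * u"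
      using u_lower \<open>\<eta> < 1 / 2\<close> by (intro mult_left_mono) auto
    moreover have "(1 / 2 - \<eta>) * A - 1 \<le> (1 / 2 - \<eta>) * (A - 1)"
      using \<eta> unfolding right_diff_distrib by (intro diff_left_mono) simp
    ultimately show ?thesis
      by (rule order_trans[rotated])
  qed
  have exp_L: "exp L = real p / real k"
    using k unfolding L by simp
  have powr: "2 powr - (real (n - m) / real k) = exp (- w)"
    by (simp add: powr_def w_def)
  \<comment> \<open>Constant factors of two are absorbed from here on as unit shifts in the
    exponent.\<close>
  have e: "2 \<le> exp (1::real)"
    using exp_ge_add_one_self[of "1::real"] by simp
  have "exp L * exp (- 1) \<le> exp L * (1 / 2)"
    using e by (intro mult_left_mono) (auto simp: exp_minus field_simps)
  also have "\<dots> \<le> real (p - k) / real k"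
    using k by (simp add: exp_L of_nat_diff field_simps)
  finally have "exp L * exp (- 1) * exp (- w) \<le> real (p - k) / real k * exp (- w)"
    by (rule mult_right_mono) simp
  then have "exp (L - 1 - w) \<le> \<mu> / real k"
    unfolding \<mu>_def powr by (simp flip: exp_add)
  then have mu_lower: "real k * exp (L - 1 - w) \<le> \<mu>"
    using k by (simp add: field_simps)
  have "real (p - k) \<le> real k * exp L"
    using k by (simp add: exp_L)
  then have "\<mu> \<le> real k * exp L * exp (- w)"
    unfolding \<mu>_def powr by (intro mult_right_mono) auto
  then have mu_upper: "\<mu> \<le> real k * exp (L - w)"
    by (simp add: mult.assoc flip: exp_add)
  have "1 \<le> exp (L - 1 - w)"
    using w1 L_a by simp
  then have "real k * 1 \<le> real k * exp (L - 1 - w)"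
    by (intro mult_left_mono) auto
  then show mu_ge: "real k \<le> \<mu>"
    using mu_lower by simp

  assume Z: "\<bar>real Z - \<mu>\<bar> \<le> \<mu> / 2" and l: "real l \<le> (1 - \<delta>) * real k"
  have "real k * exp (L - 2 - w) \<le> \<mu> / 2"
  proof -
    have "exp (L - 2 - w) = exp (L - 1 - w) / exp 1"
      by (simp flip: exp_diff)
    also have "\<dots> \<le> exp (L - 1 - w) / 2"
      using e by (intro divide_left_mono) auto
    finally have "real k * exp (L - 2 - w) \<le> real k * (exp (L - 1 - w) / 2)"
      by (intro mult_left_mono) auto
    then show ?thesis
      using mu_lower by simp
  qed
  also have "\<dots> \<le> real Z"
    using Z by linarith
  finally have Z_ge: "exp (L - 2 - w) \<le> real Z / real k"
    using k by (simp add: field_simps)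
  have "real Z \<le> real k * exp (L - w + 1)"
  proof -
    have "real Z \<le> 2 * \<mu>"
      using Z mu_ge by linarith
    also have "\<dots> \<le> exp 1 * (real k * exp (L - w))"
      using e mu_upper mu_ge by (intro mult_mono) auto
    finally show ?thesis
      by (simp add: exp_add mult_ac)
  qed
  then have Z_le: "real Z / real k \<le> exp (L - w + 1)"
    using k by (simp add: field_simps)
  have Z_pos: "0 < real Z / real k"
    by (rule less_le_trans[OF exp_gt_zero Z_ge])
  have ln_Z: "L - 2 - w \<le> ln (real Z / real k)" "ln (real Z / real k) \<le> L - w + 1"
    using ln_mono[OF Z_ge exp_gt_zero] ln_mono[OF Z_le Z_pos] by simp_all
  \<comment> \<open>The accumulated loss is \<open>5\<close>, at most half of \<open>a * L\<close>;
    this is the origin of the bound \<open>10\<close>.\<close>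
  have Z_lower: "a * L / 2 \<le> ln (real Z / real k)"
    using ln_Z(1) w1 L_a by linarith
  then have "0 < ln (real Z / real k)"
    using L_a by linarith
  \<comment> \<open>The convention \<open>ln 0 = 0\<close> excludes \<open>Z = 0\<close> here,
    because the logarithm is positive.\<close>
  then have "k \<le> Z"
    using k by (cases "Z = 0") (auto simp: ln_div)
  note count = ln_count_bounds[OF k(1) \<open>k \<le> Z\<close> \<delta> l]
  have "0 < \<delta> * real k"
    using k \<delta> by simp
  then have "real l < real k"
    using l unfolding left_diff_distrib by linarith
  then have "l < k"
    by simp
  have "0 < (1 / 2 - \<eta>) * u"
    using half_lower L_b L \<delta> divide_pos_pos[of 2 \<delta>] unfolding bL left_diff_distrib by linarith
  then have "0 < (1 / 2 - \<eta>) * real n"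
    using \<open>\<eta> < 1 / 2\<close> by (auto simp: u_def zero_less_mult_iff zero_less_divide_iff)
  then have "0 < m"
    using m_lower by simp
  have "2 / \<delta> + 1 + ln (real Z / real k) \<le> real m * ln 2 / real k"
  proof -
    have "2 / \<delta> + 1 + ln (real Z / real k) \<le> 2 / \<delta> + 3 + L - ((1 / 2 - \<eta>) * A)"
      using ln_Z(2) w_lower half_lower by linarith
    \<comment> \<open>By \<open>bL\<close> this is exactly the assumption
      \<open>2 / \<delta> + 4 \<le> b * L\<close>. The quantity \<open>(1 / 2 - \<eta>) * A\<close>
      counts twice: the negative tests shrink the candidate set and the positive tests supply the
      denominator of the equation for \<open>F\<close>.\<close>
    also have "\<dots> \<le> (1 / 2 - \<eta>) * A - 1"
      using L_b unfolding bL left_diff_distrib by linarith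
    also have "\<dots> \<le> real m * ln 2 / real k"
      using half_lower scale(1)[OF m_lower] by linarith
    finally show ?thesis .
  qed
  then have "real (k - l) * (2 / \<delta> + 1 + ln (real Z / real k)) \<le> real (k - l) * (real m * ln 2 / real k)"
    by (intro mult_left_mono) auto
  also have "\<dots> = real m * (1 - real l / real k) * ln 2"
    using k \<open>l < k\<close> by (simp add: of_nat_diff field_simps)
  finally have "\<exists>!x. is_F (k + Z) k m (real l / real k) x"
    using count(1,2) \<open>l < k\<close> \<open>0 < m\<close> by (intro is_F_ex1) auto
  \<comment> \<open>The constant \<open>20\<close> combines \<open>m \<le> 10 * L * k\<close> with
    the \<open>2\<close> in \<open>Z_lower\<close>.\<close>
  moreover have "\<delta> * a / 20 * real m \<le> ln (real ((k choose l) * ((k + Z - k) choose (k - l))))"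
  proof -
    have "A \<le> 2 * L"
      unfolding A_def using L mult_right_mono[OF \<open>1 / R \<le> 2\<close>, of L] by simp
    then have "u \<le> 5 * L"
      using u_upper L by linarith
    have "real m * (1 / 2) \<le> real n * ln 2"
      using \<open>m \<le> n\<close> ln2 by (intro mult_mono) auto
    also have "\<dots> \<le> 5 * L * real k"
      using \<open>u \<le> 5 * L\<close> k by (simp add: u_def field_simps)
    finally have "real m \<le> 10 * L * real k"
      by simp
    moreover have "0 \<le> a"
      using L_a L(2) mult_nonpos_nonneg[of a L] by linarith
    ultimately have "\<delta> * a / 20 * real m \<le> \<delta> * a / 20 * (10 * L * real k)"
      using \<delta> by (intro mult_left_mono) auto
    also have "\<dots> = \<delta> * real k * (a * L / 2)"
      by simp
    also have "\<dots> \<le> \<delta> * real k * ln (real Z / real k)"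
      using Z_lower \<delta> by (intro mult_left_mono) auto
    finally show ?thesis
      using count(3) by simp
  qed
  ultimately show "(\<exists>!x. is_F (k + Z) k m (real l / real k) x) \<and>
      \<delta> * a / 20 * real m \<le> ln (real ((k choose l) * ((k + Z - k) choose (k - l))))"
    by blast
qed

section \<open>The bound with high probability\<close>

context fixed_defectives
begin

lemma p_rem_eq: "p_rem p n (S, A) = k + card (potential_defectives p n (S, A) - S)"
  using S_subset_potential_defectives[of A] finite_potential_defectives[of A] finite_S card_S
    card_mono[OF finite_potential_defectives S_subset_potential_defectives, of A]
  by (simp add: p_rem_def card_Diff_subset)

text \<open>The centre \<open>\<mu>\<close> depends on the random number of positive tests. So
  Hoeffding first confines \<open>n_pos\<close>, and Chebyshev is then applied separately for each
  positive set of typical size, where \<open>\<mu>\<close> is at least \<open>M\<close>.\<close>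

lemma prob_atypical_le:
  fixes \<eta> M :: real
  defines "\<mu> \<equiv> \<lambda>m. real (p - k) * (1 - q) ^ (n - m)"
  assumes \<eta>: "0 \<le> \<eta>" and n: "0 < n" and p: "k < p" and M: "0 < M"
    and \<mu>: "\<And>m. \<bar>real m - n / 2\<bar> \<le> \<eta> * n \<Longrightarrow> M \<le> \<mu> m"
  shows "measure_pmf.prob design_pmf {A. \<not> (\<bar>real (n_pos n (S, A)) - n / 2\<bar> \<le> \<eta> * n \<and>
      \<bar>real (card (potential_defectives p n (S, A) - S)) - \<mu> (n_pos n (S, A))\<bar> \<le> \<mu> (n_pos n (S, A)) / 2)}
    \<le> 2 * exp (- 2 * real n * \<eta>\<^sup>2) + 4 / M"
proof -
  let ?Z = "\<lambda>A. real (card (potential_defectives p n (S, A) - S))"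
  let ?E1 = "{A. \<eta> * n \<le> \<bar>real (n_pos n (S, A)) - n / 2\<bar>}"
  let ?E2 = "{A. \<bar>real (n_pos n (S, A)) - n / 2\<bar> \<le> \<eta> * n \<and>
    \<mu> (n_pos n (S, A)) / 2 < \<bar>?Z A - \<mu> (n_pos n (S, A))\<bar>}"
  have "measure_pmf.prob design_pmf ?E2 \<le> 4 / M"
  proof (rule prob_le_by_cells[OF finite_design_pmf, where \<Phi> = "\<lambda>A. positive_tests n (S, A)"])
    fix P
    show "measure_pmf.prob design_pmf {A \<in> ?E2. positive_tests n (S, A) = P} \<le>
        4 / M * measure_pmf.prob design_pmf {A. positive_tests n (S, A) = P}"
    proof (cases "P \<subseteq> {1..n} \<and> \<bar>real (card P) - n / 2\<bar> \<le> \<eta> * n")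
      case True
      then have "M \<le> \<mu> (card P)"
        using \<mu> by simp
      have "measure_pmf.prob design_pmf {A \<in> ?E2. positive_tests n (S, A) = P} \<le>
          measure_pmf.prob design_pmf {A. positive_tests n (S, A) = P \<and>
            \<mu> (card P) / 2 < \<bar>?Z A - \<mu> (card P)\<bar>}"
        by (intro measure_pmf.finite_measure_mono) (auto simp: n_pos_def)
      also have "\<dots> \<le> 4 / \<mu> (card P) * measure_pmf.prob design_pmf {A. positive_tests n (S, A) = P}"
        unfolding \<mu>_def using True p by (intro potential_defectives_tail) auto
      also have "\<dots> \<le> 4 / M * measure_pmf.prob design_pmf {A. positive_tests n (S, A) = P}"
        using \<open>M \<le> \<mu> (card P)\<close> M by (intro mult_right_mono divide_left_mono) auto
      finally show ?thesis .
    next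
      case False
      then have "{A \<in> ?E2. positive_tests n (S, A) = P} = {}"
        by (auto simp: n_pos_def positive_tests_def)
      then show ?thesis
        using M by (simp only:) simp
    qed
  qed (use M in simp)
  moreover have "measure_pmf.prob design_pmf ?E1 \<le> 2 * exp (- 2 * real n * \<eta>\<^sup>2)"
    using \<eta> n by (rule n_pos_tail)
  moreover have "measure_pmf.prob design_pmf {A. \<not> (\<bar>real (n_pos n (S, A)) - n / 2\<bar> \<le> \<eta> * n \<and>
      \<bar>?Z A - \<mu> (n_pos n (S, A))\<bar> \<le> \<mu> (n_pos n (S, A)) / 2)} \<le>
      measure_pmf.prob design_pmf (?E1 \<union> ?E2)"
    by (intro measure_pmf.finite_measure_mono subsetI) (auto simp: not_le)
  moreover have "\<dots> \<le> measure_pmf.prob design_pmf ?E1 + measure_pmf.prob design_pmf ?E2"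
    by (intro measure_Un_le) auto
  ultimately show ?thesis
    by linarith
qed

text \<open>On a typical outcome \<open>F\<close> exists for every \<open>l\<close> in
  \<open>L\<close>, so failure can come only from an under-explaining candidate. The error terms are
  those of Hoeffding, Chebyshev and the union bound, in this order.\<close>

lemma prob_bound_fails_le:
  fixes \<eta> M c C :: real and L :: "nat set"
  defines "\<mu> \<equiv> \<lambda>m. real (p - k) * (1 - q) ^ (n - m)"
  assumes \<eta>: "0 \<le> \<eta>" and n: "0 < n" and p: "k < p" and M: "0 < M" and c: "0 < c" and C: "0 \<le> C"
    and L: "L \<subseteq> {..<k}"
    and \<mu>: "\<And>m. \<bar>real m - n / 2\<bar> \<le> \<eta> * n \<Longrightarrow> M \<le> \<mu> m"
    and typical: "\<And>m Z l. \<bar>real m - n / 2\<bar> \<le> \<eta> * n \<Longrightarrow> \<bar>real Z - \<mu> m\<bar> \<le> \<mu> m / 2 \<Longrightarrow> l \<in> L \<Longrightarrow>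
      (\<exists>!x. is_F (k + Z) k m (real l / real k) x) \<and>
      c * real m \<le> ln (real ((k choose l) * ((k + Z - k) choose (k - l))))"
  shows "measure_pmf.prob design_pmf {A. \<not> (\<forall>l\<in>L.
      (\<exists>!x. is_F (p_rem p n (S, A)) k (n_pos n (S, A)) (real l / real k) x) \<and>
      ereal (real (n_pos n (S, A)) * F (p_rem p n (S, A)) k (n_pos n (S, A)) (real l / real k)
        - C * ln (real k)) \<le> phi p k n (S, A) l)}
    \<le> 2 * exp (- 2 * real n * \<eta>\<^sup>2) + 4 / M + real k * real k powr - (c * C)"
    (is "measure_pmf.prob _ ?fail \<le> _")
proof -
  define G where "G m d \<longleftrightarrow> (\<forall>l\<in>L. (\<exists>!x. is_F d k m (real l / real k) x) \<and>
      c * real m \<le> ln (real ((k choose l) * ((d - k) choose (k - l)))))" for m d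
  let ?Z = "\<lambda>A. real (card (potential_defectives p n (S, A) - S))"
  let ?E1 = "{A. \<not> (\<bar>real (n_pos n (S, A)) - n / 2\<bar> \<le> \<eta> * n \<and>
    \<bar>?Z A - \<mu> (n_pos n (S, A))\<bar> \<le> \<mu> (n_pos n (S, A)) / 2)}"
  let ?E2 = "{A. G (n_pos n (S, A)) (p_rem p n (S, A)) \<and>
      (\<exists>l\<in>L. A \<in> under_explained l (real (n_pos n (S, A)) *
        F (p_rem p n (S, A)) k (n_pos n (S, A)) (real l / real k) - C * ln (real k)))}"
  have "?fail \<subseteq> ?E1 \<union> ?E2"
  proof
    fix A assume fail: "A \<in> ?fail"
    show "A \<in> ?E1 \<union> ?E2"
    proof (cases "A \<in> ?E1")
      case False
      then have G: "G (n_pos n (S, A)) (p_rem p n (S, A))"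
        unfolding G_def p_rem_eq using typical by blast
      obtain l where "l \<in> L" and "\<not> ereal (real (n_pos n (S, A)) *
          F (p_rem p n (S, A)) k (n_pos n (S, A)) (real l / real k) - C * ln (real k)) \<le> phi p k n (S, A) l"
        using fail G unfolding G_def by blast
      then show ?thesis
        using G phi_ge by blast
    qed simp
  qed
  then have "measure_pmf.prob design_pmf ?fail \<le> measure_pmf.prob design_pmf (?E1 \<union> ?E2)"
    by (rule measure_pmf.finite_measure_mono) simp
  also have "\<dots> \<le> measure_pmf.prob design_pmf ?E1 + measure_pmf.prob design_pmf ?E2"
    by (intro measure_Un_le) auto
  also have "\<dots> \<le> (2 * exp (- 2 * real n * \<eta>\<^sup>2) + 4 / M) + real k * real k powr - (c * C)"
  proof (rule add_mono)
    show "measure_pmf.prob design_pmf ?E1 \<le> 2 * exp (- 2 * real n * \<eta>\<^sup>2) + 4 / M"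
      unfolding \<mu>_def by (rule prob_atypical_le[OF \<eta> n p M \<mu>[unfolded \<mu>_def]])
    show "measure_pmf.prob design_pmf ?E2 \<le> real k * real k powr - (c * C)"
      by (rule prob_some_under_explained[OF c C L]) (simp add: G_def)
  qed
  finally show ?thesis .
qed

end

section \<open>Asymptotics in the sparse regime and the final limit\<close>

lemma ln_binomial_bounds:
  assumes "0 < k" "k \<le> p"
  shows "real k * ln (real p / real k) \<le> ln (real (p choose k))"
    and "ln (real (p choose k)) \<le> real k * (ln (real p / real k) + 1)"
  using ln_binomial_lower[OF assms] ln_binomial_upper[OF assms] by (simp_all add: add.commute)

text \<open>\<open>k\<close> is at least a constant times \<open>p powr \<alpha>\<close>, and
  \<open>p / k\<close> at least a constant times \<open>p powr (1 - \<alpha>)\<close>; both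
  exponents are positive.\<close>

lemma asymptotics_of_sparsity:
  fixes k :: "nat \<Rightarrow> nat"
  assumes "0 < \<alpha>" "\<alpha> < 1" "(\<lambda>p. real (k p)) \<in> \<Theta>(\<lambda>p. real p powr \<alpha>)"
  shows "filterlim (\<lambda>p. real (k p)) at_top sequentially"
    and "filterlim (\<lambda>p. ln (real p / real (k p))) at_top sequentially"
proof -
  obtain c1 where c1: "0 < c1" "\<forall>\<^sub>F p in sequentially. c1 * norm (real p powr \<alpha>) \<le> norm (real (k p))"
    using landau_omega.bigE[of "\<lambda>p. real (k p)" sequentially "\<lambda>p. real p powr \<alpha>"] bigthetaD2[OF assms(3)] by blast
  obtain c2 where c2: "0 < c2" "\<forall>\<^sub>F p in sequentially. norm (real (k p)) \<le> c2 * norm (real p powr \<alpha>)"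
    using landau_o.bigE[of "\<lambda>p. real (k p)" sequentially "\<lambda>p. real p powr \<alpha>"] bigthetaD1[OF assms(3)] by blast
  have powr_top: "filterlim (\<lambda>p. c * real p powr e) at_top sequentially" if "0 < c" "0 < e" for c e
  proof (rule filterlim_tendsto_pos_mult_at_top[OF tendsto_const \<open>0 < c\<close>])
    have "filterlim (\<lambda>p. exp (e * ln (real p))) at_top sequentially"
      using that
      by (intro filterlim_compose[OF exp_at_top] filterlim_tendsto_pos_mult_at_top[OF tendsto_const]
          filterlim_compose[OF ln_at_top filterlim_real_sequentially])
    moreover have "\<forall>\<^sub>F p in sequentially. exp (e * ln (real p)) \<le> real p powr e"
      using eventually_gt_at_top[of 0] by eventually_elim (simp add: powr_def)
    ultimately show "filterlim (\<lambda>p. real p powr e) at_top sequentially"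
      by (rule filterlim_at_top_mono)
  qed
  show k: "filterlim (\<lambda>p. real (k p)) at_top sequentially"
    by (rule filterlim_at_top_mono[OF powr_top[OF c1(1) assms(1)]], use c1(2) in simp)
  have "filterlim (\<lambda>p. real p / real (k p)) at_top sequentially"
  proof (rule filterlim_at_top_mono[OF powr_top[of "1 / c2" "1 - \<alpha>"]])
    show "\<forall>\<^sub>F p in sequentially. 1 / c2 * real p powr (1 - \<alpha>) \<le> real p / real (k p)"
      using c2(2) eventually_gt_at_top[of 0] filterlim_at_top_dense[THEN iffD1, OF k, rule_format, of 0]
    proof eventually_elim
      case (elim p)
      have "1 / c2 * real p powr (1 - \<alpha>) = real p / (c2 * real p powr \<alpha>)"
        using elim by (simp add: powr_diff)
      also have "\<dots> \<le> real p / real (k p)"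
        using elim by (intro divide_left_mono) auto
      finally show ?case .
    qed
  qed (use c2 assms in simp_all)
  then show "filterlim (\<lambda>p. ln (real p / real (k p))) at_top sequentially"
    by (rule filterlim_compose[OF ln_at_top])
qed

lemma fixed_defectives_nu:
  assumes "0 < k" "S \<subseteq> {1..p}" "card S = k"
  shows "fixed_defectives p k (nu k / real k) S"
proof -
  have "0 < nu k \<and> nu k \<le> real k \<and> (1 - nu k / real k) ^ k = 1 / 2"
    unfolding nu_def by (rule theI'[OF nu_ex1[OF assms(1)]])
  then show ?thesis
    using assms by unfold_locales auto
qed

theorem theoremB8:
  fixes R \<alpha> :: real and k n :: "nat \<Rightarrow> nat"
  assumes "1 / 2 < R" and "R < 1"
    and "0 < \<alpha>" and "\<alpha> < 1"
    and "(\<lambda>p. real (k p)) \<in> \<Theta>(\<lambda>p. real p powr \<alpha>)"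
    and "\<forall>\<^sub>F p in sequentially. \<bar>real (n p) - log 2 (real (p choose k p)) / R\<bar> < 1"
  shows "\<forall>\<epsilon>::real. \<epsilon> > 0 \<longrightarrow> (\<exists>C::real.
    aas (\<lambda>p. gt_pmf p (k p) (n p))
      (\<lambda>p \<omega>. \<forall>l::nat. int l \<le> \<lfloor>(1 - \<epsilon>) * real (k p)\<rfloor> \<longrightarrow>
         (\<exists>!x. is_F (p_rem p (n p) \<omega>) (k p) (n_pos (n p) \<omega>) (real l / real (k p)) x) \<and>
         phi p (k p) (n p) \<omega> l \<ge>
           ereal (real (n_pos (n p) \<omega>)
                    * F (p_rem p (n p) \<omega>) (k p) (n_pos (n p) \<omega>) (real l / real (k p))
                  - C * ln (real (k p)))))"
proof (intro allI impI)
  fix \<epsilon> :: real assume \<epsilon>: "0 < \<epsilon>"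
  \<comment> \<open>The counting bounds need \<open>\<delta> \<le> 1\<close>; for
    \<open>\<epsilon> > 1\<close> and positive \<open>k\<close> no \<open>l\<close> is in
    range.\<close>
  define \<delta> where "\<delta> = min \<epsilon> 1"
  \<comment> \<open>The tolerance is small enough to keep both gaps, of \<open>R\<close> above
    \<open>1 / 2\<close> and below \<open>1\<close>, which become \<open>0 < a\<close> and
    \<open>0 < b\<close>.\<close>
  define \<eta> where "\<eta> = min ((2 * R - 1) / 4) ((1 - R) / 4)"
  define a where "a = 1 - (1 / 2 + \<eta>) / R"
  define b where "b = (1 - 2 * \<eta>) / R - 1"
  define c where "c = \<delta> * a / 20"
  have \<delta>: "0 < \<delta>" "\<delta> \<le> 1" "\<delta> \<le> \<epsilon>"
    using \<epsilon> by (simp_all add: \<delta>_def)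
  have \<eta>: "0 < \<eta>" "1 / 2 + \<eta> < R" "R < 1 - 2 * \<eta>"
    using assms(1,2) by (auto simp: \<eta>_def min_def field_simps)
  have ab: "0 < a" "0 < b"
    using \<eta> assms(1,2) by (simp_all add: a_def b_def field_simps)
  have c: "0 < c"
    using \<delta> ab by (simp add: c_def)
  let ?L = "\<lambda>p. ln (real p / real (k p))"
  \<comment> \<open>The witness is \<open>C = 3 / c\<close>: the union bound then fails with
    probability at most \<open>k * k powr - 3\<close>, that is \<open>k powr - 2\<close>.\<close>
  let ?P = "\<lambda>p \<omega>. \<forall>l::nat. int l \<le> \<lfloor>(1 - \<epsilon>) * real (k p)\<rfloor> \<longrightarrow>
         (\<exists>!x. is_F (p_rem p (n p) \<omega>) (k p) (n_pos (n p) \<omega>) (real l / real (k p)) x) \<and>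
         phi p (k p) (n p) \<omega> l \<ge>
           ereal (real (n_pos (n p) \<omega>)
                    * F (p_rem p (n p) \<omega>) (k p) (n_pos (n p) \<omega>) (real l / real (k p))
                  - 3 / c * ln (real (k p)))"
  let ?err = "\<lambda>p. 2 * exp (- 2 * \<eta>\<^sup>2 * (real (k p) - 1)) + 4 / real (k p) + real (k p) powr - 2"
  note lim = asymptotics_of_sparsity[OF assms(3-5)]
  have lower: "\<forall>\<^sub>F p in sequentially. 1 - ?err p \<le> measure_pmf.prob (gt_pmf p (k p) (n p)) {\<omega>. ?P p \<omega>}"
    using assms(6)
      filterlim_at_top[THEN iffD1, OF lim(1), rule_format, of 1]
      filterlim_at_top[THEN iffD1, OF lim(2), rule_format, of "max 1 (max (10 / a) ((2 / \<delta> + 4) / b))"]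
  proof eventually_elim
    case (elim p)
    define K N L where "K = k p" and "N = n p" and "L = ln (real p / real K)"
    have K: "0 < K"
      using elim(2) by (simp add: K_def)
    have L: "1 \<le> L" "10 \<le> a * L" "2 / \<delta> + 4 \<le> b * L"
      using elim(3) ab by (simp_all add: K_def L_def field_simps)
    have "0 < p"
      using L by (cases "p = 0") (simp_all add: L_def)
    then have "exp L = real p / real K"
      using K by (simp add: L_def)
    moreover have "2 \<le> exp L"
      using exp_ge_add_one_self[of L] L by linarith
    ultimately have "2 \<le> real p / real K"
      by simp
    then have "real (2 * K) \<le> real p"
      using K by (simp add: pos_le_divide_eq)
    then have p: "2 * K \<le> p"
      by (simp only: of_nat_le_iff)
    have "K \<le> p"
      using p by simp
    have ln2: "0 < ln (2::real)" "ln (2::real) < 1"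
      using ln2_le_25_over_36 by simp_all
    \<comment> \<open>Multiplying by \<open>ln 2\<close> passes to natural logarithms, and the
      rounding error stays below \<open>1\<close> because \<open>ln 2 < 1\<close>.\<close>
    have "\<bar>real N - log 2 (real (p choose K)) / R\<bar> * ln 2 < 1 * ln 2"
      using elim(1) ln2 by (intro mult_strict_right_mono) (simp_all add: N_def K_def)
    also have "\<bar>real N - log 2 (real (p choose K)) / R\<bar> * ln 2 =
        \<bar>real N * ln 2 - ln (real (p choose K)) / R\<bar>"
    proof -
      have "(real N - log 2 (real (p choose K)) / R) * ln 2 = real N * ln 2 - ln (real (p choose K)) / R"
        using ln2 by (simp add: log_def left_diff_distrib)
      moreover have "\<bar>real N - log 2 (real (p choose K)) / R\<bar> * ln 2 =
          \<bar>(real N - log 2 (real (p choose K)) / R) * ln 2\<bar>"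
        using ln2 by (simp add: abs_mult)
      ultimately show ?thesis
        by simp
    qed
    finally have N: "\<bar>real N * ln 2 - ln (real (p choose K)) / R\<bar> < 1"
      using ln2 by simp
    have "real K * L / R \<le> ln (real (p choose K)) / R"
      "ln (real (p choose K)) / R \<le> real K * (L + 1) / R"
      using ln_binomial_bounds[OF K \<open>K \<le> p\<close>] assms(1)
      unfolding L_def by (intro divide_right_mono; simp)+
    with N have N_bounds: "real K * L / R - 1 \<le> real N * ln 2" "real N * ln 2 \<le> real K * (L + 1) / R + 1"
      by linarith+
    have "real K * 1 \<le> real K * (L / R)"
      using L assms(1,2) by (intro mult_left_mono) (simp_all add: field_simps)
    moreover have "real N * ln 2 \<le> real N"
      using ln2 by (simp add: mult_left_le)
    ultimately have "real K - 1 \<le> real N"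
      using N_bounds(1) by simp
    have "real K * 1 < real K * (L / R)"
      using L assms(1,2) K by (intro mult_strict_left_mono) (simp_all add: field_simps)
    then have "0 < real N * ln 2"
      using N_bounds(1) K by simp
    then have "0 < N"
      by (simp add: zero_less_mult_iff)
    let ?I = "{l::nat. int l \<le> \<lfloor>(1 - \<epsilon>) * real K\<rfloor>}"
    have I: "real l \<le> (1 - \<delta>) * real K" if "l \<in> ?I" for l
    proof -
      have "real l \<le> (1 - \<epsilon>) * real K"
        using that by (simp add: le_floor_iff)
      also have "\<dots> \<le> (1 - \<delta>) * real K"
        using \<delta> by (intro mult_right_mono) auto
      finally show ?thesis .
    qed
    have "?I \<subseteq> {..<K}"
    proof
      fix l assume "l \<in> ?I"
      moreover have "0 < \<delta> * real K"
        using \<delta> K by simp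
      ultimately have "real l < real K"
        using I[of l] unfolding left_diff_distrib by linarith
      then show "l \<in> {..<K}"
        by simp
    qed
    have "measure_pmf.prob (gt_pmf p K N) {\<omega>. \<not> ?P p \<omega>} \<le>
        2 * exp (- 2 * real N * \<eta>\<^sup>2) + 4 / real K + real K * real K powr - (c * (3 / c))"
      unfolding gt_pmf_def
    proof (rule prob_pair_pmf_le)
      fix S assume "S \<in> set_pmf (pmf_of_set {S. S \<subseteq> {1..p} \<and> card S = K})"
      moreover have "{S. S \<subseteq> {1..p} \<and> card S = K} \<noteq> {}"
        using obtain_subset_with_card_n[of K "{1..p}"] \<open>K \<le> p\<close> by auto
      moreover have "finite {S. S \<subseteq> {1..p} \<and> card S = K}"
        by simp
      ultimately have S: "S \<subseteq> {1..p}" "card S = K"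
        by simp_all
      interpret fixed_defectives p K N "nu K / real K" S
        using K S by (rule fixed_defectives_nu)
      note range = counts_in_range[OF assms(1,2) \<eta>(1,2) \<delta>(1,2) K p L_def L(1)
          L(2)[unfolded a_def] L(3)[unfolded b_def] N_bounds]
      have "measure_pmf.prob design_pmf {A. \<not> (\<forall>l\<in>?I.
          (\<exists>!x. is_F (p_rem p N (S, A)) K (n_pos N (S, A)) (real l / real K) x) \<and>
          ereal (real (n_pos N (S, A)) * F (p_rem p N (S, A)) K (n_pos N (S, A)) (real l / real K)
            - 3 / c * ln (real K)) \<le> phi p K N (S, A) l)}
        \<le> 2 * exp (- 2 * real N * \<eta>\<^sup>2) + 4 / real K + real K * real K powr - (c * (3 / c))"
      proof (rule prob_bound_fails_le)
        show "real K \<le> real (p - K) * (1 - nu K / real K) ^ (N - m)"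
          if "\<bar>real m - real N / 2\<bar> \<le> \<eta> * real N" for m
          unfolding power_miss_eq_powr using that by (rule range(1))
        show "(\<exists>!x. is_F (K + Z) K m (real l / real K) x) \<and>
            c * real m \<le> ln (real ((K choose l) * ((K + Z - K) choose (K - l))))"
          if "\<bar>real m - real N / 2\<bar> \<le> \<eta> * real N"
            "\<bar>real Z - real (p - K) * (1 - nu K / real K) ^ (N - m)\<bar> \<le>
              real (p - K) * (1 - nu K / real K) ^ (N - m) / 2"
            "l \<in> ?I" for m Z l
          using range(2)[OF that(1) that(2)[unfolded power_miss_eq_powr] I[OF that(3)]]
          unfolding c_def a_def .
      qed (use \<eta> \<open>0 < N\<close> p K c \<open>?I \<subseteq> {..<K}\<close> in auto)
      then show "measure_pmf.prob (Pi_pmf ({1..N} \<times> {1..p}) False (\<lambda>_. bernoulli_pmf (nu K / real K)))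
          {A. (S, A) \<in> {\<omega>. \<not> ?P p \<omega>}} \<le>
          2 * exp (- 2 * real N * \<eta>\<^sup>2) + 4 / real K + real K * real K powr - (c * (3 / c))"
        unfolding design_pmf_def unfolding K_def N_def Ball_def mem_Collect_eq .
    qed simp
    also have "real K * real K powr - (c * (3 / c)) = real K powr - 2"
      using c K powr_add[of "real K" 1 "- 3"] by simp
    \<comment> \<open>Replacing \<open>N\<close> by its lower bound \<open>K - 1\<close> leaves an
      error depending on \<open>k\<close> alone, whose limit is that of a function of one real
      variable.\<close>
    also have "2 * exp (- 2 * real N * \<eta>\<^sup>2) \<le> 2 * exp (- 2 * \<eta>\<^sup>2 * (real K - 1))"
      using mult_left_mono[OF \<open>real K - 1 \<le> real N\<close>, of "2 * \<eta>\<^sup>2"] by (simp add: mult_ac)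
    finally have fail: "measure_pmf.prob (gt_pmf p K N) {\<omega>. \<not> ?P p \<omega>} \<le> ?err p"
      by (simp add: K_def)
    have "measure_pmf.prob (gt_pmf p K N) {\<omega>. ?P p \<omega>} =
        1 - measure_pmf.prob (gt_pmf p K N) {\<omega>. \<not> ?P p \<omega>}"
      using measure_pmf.prob_compl[of "{\<omega>. \<not> ?P p \<omega>}" "gt_pmf p K N"]
      by (simp add: Compl_eq_Diff_UNIV[symmetric] Collect_neg_eq[symmetric])
    then show ?case
      using fail unfolding K_def N_def by linarith
  qed
  have lower_lim: "(\<lambda>p. 1 - ?err p) \<longlonglongrightarrow> 1"
  proof -
    have "((\<lambda>x::real. 1 - (2 * exp (- 2 * \<eta>\<^sup>2 * (x - 1)) + 4 / x + x powr - 2)) \<longlongrightarrow> 1 - (2 * 0 + 0 + 0)) at_top"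
    proof (intro tendsto_intros)
      have "filterlim (\<lambda>x::real. - 1 + x) at_top at_top"
        by (rule filterlim_tendsto_add_at_top[OF tendsto_const filterlim_ident])
      then have "filterlim (\<lambda>x::real. - (2 * \<eta>\<^sup>2 * (x - 1))) at_bot at_top"
        using \<eta> by (intro filterlim_uminus_at_top[THEN iffD1] filterlim_tendsto_pos_mult_at_top[OF tendsto_const])
          (simp_all add: add.commute)
      then show "((\<lambda>x::real. exp (- 2 * \<eta>\<^sup>2 * (x - 1))) \<longlongrightarrow> 0) at_top"
        by (intro filterlim_compose[OF exp_at_bot]) simp
      show "((\<lambda>x::real. 4 / x) \<longlongrightarrow> 0) at_top"
        by (intro tendsto_divide_0[OF tendsto_const] filterlim_at_top_imp_at_infinity filterlim_ident)
      show "((\<lambda>x::real. x powr - 2) \<longlongrightarrow> 0) at_top"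
        by (intro tendsto_neg_powr filterlim_ident) simp
    qed
    then show ?thesis
      using filterlim_compose[OF _ lim(1)] by simp
  qed
  have upper: "\<forall>\<^sub>F p in sequentially. measure_pmf.prob (gt_pmf p (k p) (n p)) {\<omega>. ?P p \<omega>} \<le> 1"
    by (rule always_eventually) simp
  have "(\<lambda>p. measure_pmf.prob (gt_pmf p (k p) (n p)) {\<omega>. ?P p \<omega>}) \<longlonglongrightarrow> 1"
    by (rule tendsto_sandwich[OF lower upper lower_lim tendsto_const])
  then show "\<exists>C::real. aas (\<lambda>p. gt_pmf p (k p) (n p))
      (\<lambda>p \<omega>. \<forall>l::nat. int l \<le> \<lfloor>(1 - \<epsilon>) * real (k p)\<rfloor> \<longrightarrow>
         (\<exists>!x. is_F (p_rem p (n p) \<omega>) (k p) (n_pos (n p) \<omega>) (real l / real (k p)) x) \<and>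
         phi p (k p) (n p) \<omega> l \<ge>
           ereal (real (n_pos (n p) \<omega>)
                    * F (p_rem p (n p) \<omega>) (k p) (n_pos (n p) \<omega>) (real l / real (k p))
                  - C * ln (real (k p))))"
    unfolding aas_def by blast
qed

end
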